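(* Let $\beta>1$ be irrational and let $n\ge 2$ be an integer. Then for every real $\beta'>1$ with $\beta'\neq\beta$ we have $\mu_{(\beta,n)}\neq\mu_{(\beta',n)}$.
   Context: For a real number $\gamma>1$ let $T_\gamma:[0,1)\to[0,1)$, $T_\gamma(x)=\gamma x \bmod 1$. For real $\beta>1$ and an integer $n\ge 2$, the alternate base transformation $K_{(\beta,n)}:\{0,1\}\times[0,1)\to\{0,1\}\times[0,1)$ is $K_{(\beta,n)}(0,x)=(1,T_\beta(x))$, $K_{(\beta,n)}(1,x)=(0,T_n(x))$. For reals $\gamma_1,\gamma_2>1$, $T_{\gamma_1\circ\gamma_2}:=T_{\gamma_1}\circ T_{\gamma_2}$ (a piecewise linear map of constant slope $\gamma_1\gamma_2$), and $\mu_{\gamma_1\circ\gamma_2}$ denotes its unique invariant probability measure absolutely continuous with respect to Lebesgue measure. The absolutely continuous invariant probability measure $\mu_{(\beta,n)}$ of $K_{(\beta,n)}$ is given by $\mu_{(\beta,n)}(\{0\}\times A\cup\{1\}\times B)=\tfrac12\mu_{n\circ\beta}(A)+\tfrac12\mu_{\beta\circ n}(B)$ for Borel $A,B\subseteq[0,1)$. *)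

theory Defs
  imports "HOL-Probability.Probability"
begin

definition Tmap :: "real \<Rightarrow> real \<Rightarrow> real" where
  "Tmap \<gamma> x = frac (\<gamma> * x)"

definition unit_borel :: "real measure" where
  "unit_borel = restrict_space borel {0..<1}"

definition unit_leb :: "real measure" where
  "unit_leb = restrict_space lborel {0..<1}"

definition acim :: "real \<Rightarrow> real \<Rightarrow> real measure" where
  "acim \<gamma>1 \<gamma>2 = (THE \<mu>. prob_space \<mu> \<and> sets \<mu> = sets unit_borel \<and>
      absolutely_continuous unit_leb \<mu> \<and>
      distr \<mu> unit_borel (Tmap \<gamma>1 \<circ> Tmap \<gamma>2) = \<mu>)"

text \<open>The state space {0,1} x [0,1), with 0 encoded as False and 1 as True.\<close>
definition alt_space :: "(bool \<times> real) measure" where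
  "alt_space = count_space (UNIV :: bool set) \<Otimes>\<^sub>M unit_borel"

definition alt_acim :: "real \<Rightarrow> nat \<Rightarrow> (bool \<times> real) measure" where
  "alt_acim \<beta> n = measure_of (space alt_space) (sets alt_space)
     (\<lambda>S. ennreal (1/2) * emeasure (acim (real n) \<beta>) {x. (False, x) \<in> S}
        + ennreal (1/2) * emeasure (acim \<beta> (real n)) {x. (True, x) \<in> S})"

end

theory Submission
  imports Defs
begin


text \<open>
  Writing \<open>g = n \<beta>\<close>, we have \<open>T\<^sub>n \<circ> T\<^sub>\<beta> = T\<^sub>g\<close>, whose invariant density is Parry's series
  \<open>c\<inverse> \<Sum>\<^sub>k g\<^sup>-\<^sup>k 1\<^bsub>[0, w\<^sub>k)\<^esub>\<close> with \<open>w\<^sub>k = T\<^sub>g\<^sup>k(1)\<close>. For uniqueness, the function \<open>1\<^bsub>[0,t)\<^esub> - t\<close>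
  is a coboundary of the transfer operator, so Cesaro averages depend on a density only through its
  integral. The kinks of the distribution function show the atoms of
  \<open>\<Sum>\<^sub>k g\<^sup>-\<^sup>k \<delta>\<^bsub>w\<^sub>k\<^esub>\<close>. As \<open>g > 2\<close>, the heaviest atom in \<open>(0,1)\<close> is at \<open>w\<^sub>1 = frac g\<close>, with weight in
  \<open>[1/g, 1/(g-1)]\<close>. Hence two slopes \<open>g < g'\<close> with the same measure satisfy \<open>g' = g + 1\<close> and \<open>w\<^sub>k = 0\<close> for
  \<open>k \<ge> 2\<close>. This exceptional case does occur, when \<open>g frac g\<close> is an integer, and it is excluded by
  the other component: there the density for \<open>\<beta>' = \<beta> + 1/n\<close> jumps at the irrational point
  \<open>frac \<beta>'\<close>, whereas the density for \<open>\<beta>\<close> has only one irrational jump, at \<open>frac \<beta> \<noteq> frac \<beta>'\<close>.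
\<close>

section \<open>Lebesgue measure on \<open>[0,1)\<close> and preimages under the maps
  \<open>Tmap\<close>\<close>

lemma space_unit_leb [simp]: "space unit_leb = {0..<1}"
  by (simp add: unit_leb_def)

lemma space_unit_borel [simp]: "space unit_borel = {0..<1}"
  by (simp add: unit_borel_def)

lemma sets_unit_borel_iff: "A \<in> sets unit_borel \<longleftrightarrow> A \<in> sets borel \<and> A \<subseteq> {0..<1}"
  unfolding unit_borel_def by (subst sets_restrict_space_iff) auto

lemma sets_unit_leb [simp, measurable_cong]: "sets unit_leb = sets unit_borel"
  unfolding unit_leb_def unit_borel_def by (rule sets_restrict_space_cong) simp

lemma emeasure_unit_leb: "A \<in> sets unit_borel \<Longrightarrow> emeasure unit_leb A = emeasure lborel A"
  unfolding unit_leb_def by (subst emeasure_restrict_space) (auto simp: sets_unit_borel_iff)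

lemma measure_unit_leb: "A \<in> sets unit_borel \<Longrightarrow> measure unit_leb A = measure lebesgue A"
  by (simp add: measure_def emeasure_unit_leb sets_unit_borel_iff)

interpretation unit_leb: prob_space unit_leb
  by standard (simp add: emeasure_unit_leb sets_unit_borel_iff)

lemma Tmap_range [simp]: "0 \<le> Tmap g x" "Tmap g x < 1"
  by (auto simp: Tmap_def frac_lt_1)

lemma Tmap_measurable_borel [measurable]: "Tmap g \<in> borel \<rightarrow>\<^sub>M borel"
  unfolding Tmap_def frac_def by measurable

lemma Tmap_measurable [measurable]: "Tmap g \<in> unit_borel \<rightarrow>\<^sub>M unit_borel"
  unfolding unit_borel_def by (rule measurable_restrict_space3) auto

lemma Ico_in_sets [simp]: "t \<le> 1 \<Longrightarrow> {0..<t} \<in> sets unit_borel"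
  by (auto simp: sets_unit_borel_iff)

lemma measure_unit_leb_Ico: "0 \<le> t \<Longrightarrow> t \<le> 1 \<Longrightarrow> measure unit_leb {0..<t} = t"
  by (simp add: measure_unit_leb)

lemma Tmap_vimage_sets [simp]: "A \<in> sets unit_borel \<Longrightarrow> Tmap g -` A \<inter> {0..<1} \<in> sets unit_borel"
  using measurable_sets[OF Tmap_measurable] by simp

text \<open>Induction on \<open>m\<close>: the part below 1 is \<open>A\<close> itself, and the part
  from 1 on is the set for the previous \<open>m\<close> translated by 1. At \<open>m = 0\<close>
  only \<open>A\<close> cut off at \<open>r\<close> remains.\<close>

lemma measure_frac_vimage:
  assumes A: "A \<in> sets unit_borel" and r: "0 \<le> r" "r \<le> 1"
  shows "{y. 0 \<le> y \<and> y < real m + r \<and> frac y \<in> A} \<in> sets borel \<and>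
    measure lebesgue {y. 0 \<le> y \<and> y < real m + r \<and> frac y \<in> A}
      = real m * measure unit_leb A + measure unit_leb (A \<inter> {0..<r})"
proof -
  have A': "A \<in> sets borel" "A \<subseteq> {0..<1}" using A by (auto simp: sets_unit_borel_iff)
  define S where "S = (\<lambda>m. {y. 0 \<le> y \<and> y < real m + r \<and> frac y \<in> A})"
  have [measurable]: "S m \<in> sets borel" for m
  proof -
    have "(\<lambda>y::real. frac y) \<in> borel \<rightarrow>\<^sub>M borel" unfolding frac_def by measurable
    then show ?thesis unfolding S_def using A'(1) by measurable
  qed
  have bnd: "S m \<in> lmeasurable" for m
  proof (rule bounded_set_imp_lmeasurable)
    show "bounded (S m)" by (rule bounded_subset[of "{0..real m + r}"]) (auto simp: S_def)
  qed (use \<open>S m \<in> sets borel\<close> in auto)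
  have "measure lebesgue (S m) = real m * measure unit_leb A + measure unit_leb (A \<inter> {0..<r})" for m
  proof (induction m)
    case 0
    have "S 0 = A \<inter> {0..<r}"
      unfolding S_def using A' r frac_eq by (auto simp: frac_eq)
    moreover have "A \<inter> {0..<r} \<in> sets unit_borel" using A r by auto
    ultimately show ?case by (simp add: measure_unit_leb)
  next
    case (Suc m)
    have "S (Suc m) = A \<union> (+) 1 ` S m"
    proof (intro equalityI subsetI)
      fix y assume y: "y \<in> S (Suc m)"
      show "y \<in> A \<union> (+) 1 ` S m"
      proof (cases "y < 1")
        case True then show ?thesis using y by (auto simp: S_def frac_eq)
      next
        case False
        then have "y - 1 \<in> S m" using y
          by (auto simp: S_def frac_def)
        then show ?thesis by (intro UnI2 image_eqI[of _ _ "y - 1"]) auto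
      qed
    next
      fix y assume "y \<in> A \<union> (+) 1 ` S m"
      then show "y \<in> S (Suc m)"
        using A' r by (auto simp: S_def frac_eq frac_def subset_iff)
          (smt (verit) atLeastLessThan_iff floor_eq_iff of_int_0 of_nat_0_le_iff subsetD)+
    qed
    moreover have "measure lebesgue (A \<union> (+) 1 ` S m) = measure lebesgue A + measure lebesgue ((+) 1 ` S m)"
    proof (rule measure_Un_AE)
      have "A \<inter> (+) 1 ` S m = {}" using A' by (auto simp: S_def)
      then show "AE x in lebesgue. x \<notin> A \<or> x \<notin> (+) 1 ` S m" by (auto intro!: AE_I2)
      show "A \<in> fmeasurable lebesgue"
        by (rule bounded_set_imp_lmeasurable, rule bounded_subset[of "{0..1}"]) (use A' in auto)
      show "(+) 1 ` S m \<in> fmeasurable lebesgue"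
        using bnd by (rule measurable_translation)
    qed
    moreover have "measure lebesgue ((+) 1 ` S m) = measure lebesgue (S m)"
      by (rule measure_translation)
    ultimately have "measure lebesgue (S (Suc m)) = measure lebesgue A + measure lebesgue (S m)"
      by metis
    then show ?case unfolding Suc measure_unit_leb[OF A, symmetric] by (simp add: algebra_simps)
  qed
  with \<open>\<And>m. S m \<in> sets borel\<close> show ?thesis unfolding S_def by blast
qed

text \<open>On \<open>[0,s)\<close> the map has \<open>floor (g * s)\<close> full branches and a
  last one whose image stops at \<open>Tmap g s\<close>. Each branch stretches by \<open>g\<close>,
  so multiplication by \<open>g\<close> reduces the claim to \<open>measure_frac_vimage\<close>. The
  endpoint \<open>s = 1\<close> is included, since orbits will start there.\<close>

lemma Tmap_transfer:
  assumes A: "A \<in> sets unit_borel" and g: "g > 0" and s: "0 \<le> s" "s \<le> 1"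
  shows "measure unit_leb ((Tmap g -` A \<inter> {0..<1}) \<inter> {0..<s}) =
    (of_int \<lfloor>g * s\<rfloor> * measure unit_leb A + measure unit_leb (A \<inter> {0..<Tmap g s})) / g"
proof -
  define m where "m = nat \<lfloor>g * s\<rfloor>"
  have fl: "real m = of_int \<lfloor>g * s\<rfloor>" using g s by (simp add: m_def)
  have gs: "g * s = real m + Tmap g s" unfolding fl Tmap_def frac_def by simp
  define Y where "Y = {y. 0 \<le> y \<and> y < real m + Tmap g s \<and> frac y \<in> A}"
  have Y: "Y \<in> sets borel" "measure lebesgue Y = real m * measure unit_leb A + measure unit_leb (A \<inter> {0..<Tmap g s})"
    unfolding Y_def using measure_frac_vimage[OF A, of "Tmap g s" m] by (auto simp: less_imp_le)
  have eq: "(Tmap g -` A \<inter> {0..<1}) \<inter> {0..<s} = (\<lambda>y. (1/g) *\<^sub>R y + 0) ` Y"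
  proof (intro equalityI subsetI)
    fix x assume x: "x \<in> (Tmap g -` A \<inter> {0..<1}) \<inter> {0..<s}"
    then have "g * x \<in> Y" using g s unfolding Y_def gs[symmetric] by (auto simp: Tmap_def)
    then show "x \<in> (\<lambda>y. (1/g) *\<^sub>R y + 0) ` Y" using g by (intro image_eqI[of _ _ "g * x"]) auto
  next
    fix x assume "x \<in> (\<lambda>y. (1/g) *\<^sub>R y + 0) ` Y"
    then show "x \<in> (Tmap g -` A \<inter> {0..<1}) \<inter> {0..<s}"
      using g s unfolding Y_def gs[symmetric] by (auto simp: Tmap_def field_simps)
  qed
  have "(Tmap g -` A \<inter> {0..<1}) \<inter> {0..<s} \<in> sets unit_borel" using A s by auto
  then have "measure unit_leb ((Tmap g -` A \<inter> {0..<1}) \<inter> {0..<s}) = measure lebesgue ((\<lambda>y. (1/g) *\<^sub>R y + 0) ` Y)"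
    by (simp add: measure_unit_leb eq)
  also have "\<dots> = measure lebesgue Y / g"
    using g by (subst measure_lebesgue_affine) (auto simp: field_simps)
  finally show ?thesis using Y fl by simp
qed

section \<open>Orbits and the coboundary identity\<close>

definition orbit :: "real \<Rightarrow> real \<Rightarrow> nat \<Rightarrow> real" where
  "orbit g t k = (Tmap g ^^ k) t"

lemma orbit_0 [simp]: "orbit g t 0 = t" and orbit_Suc: "orbit g t (Suc k) = Tmap g (orbit g t k)"
  by (simp_all add: orbit_def)

lemma orbit_bounds: 
  assumes "0 \<le> t" "t \<le> 1"
  shows "0 \<le> orbit g t k" "orbit g t k \<le> 1"
  using assms by (cases k; simp add: orbit_Suc less_imp_le)+

text \<open>The integral over \<open>A\<close> of the series with weights \<open>(1/g)^k\<close> and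
  indicators of the intervals from 0 to the orbit points. For \<open>t = 1\<close> this is Parry's
  density before normalisation; the orbit then starts at 1, just outside the state space.\<close>

definition pot :: "real \<Rightarrow> real \<Rightarrow> real set \<Rightarrow> real" where
  "pot g t A = (\<Sum>k. (1/g)^k * measure unit_leb (A \<inter> {0..<orbit g t k}))"

lemma pot_summable:
  assumes "g > 1"
  shows "summable (\<lambda>k. (1/g)^k * measure unit_leb (A k))"
proof (rule summable_comparison_test')
  show "summable (\<lambda>k. (1/g)^k)" using assms by (simp add: summable_geometric)
  show "norm ((1/g)^k * measure unit_leb (A k)) \<le> (1/g)^k" if "k \<ge> 0" for k
    using assms by (simp add: mult_left_le)
qed

text \<open>The bound does not depend on \<open>A\<close>, so the difference left by a telescoping
  sum over iterated preimages stays bounded.\<close>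

lemma pot_bounds:
  assumes "g > 1"
  shows "0 \<le> pot g t A" "pot g t A \<le> g / (g - 1)"
proof -
  show "0 \<le> pot g t A" unfolding pot_def using assms by (intro suminf_nonneg pot_summable) auto
  have "pot g t A \<le> (\<Sum>k. (1/g)^k)"
    unfolding pot_def using assms
    by (intro suminf_le pot_summable) (auto simp: mult_left_le summable_geometric)
  also have "\<dots> = g / (g - 1)" using assms by (subst suminf_geometric) (auto simp: field_simps)
  finally show "pot g t A \<le> g / (g - 1)" .
qed

text \<open>The coboundary identity for \<open>1\<^bsub>[0,t)\<^esub> - t\<close>, integrated over \<open>A\<close>. It holds because
  \<open>g\<^sup>-\<^sup>k\<^sup>-\<^sup>1 \<lfloor>g w\<^sub>k\<rfloor> = g\<^sup>-\<^sup>k w\<^sub>k - g\<^sup>-\<^sup>k\<^sup>-\<^sup>1 w\<^sub>k\<^sub>+\<^sub>1\<close> telescopes.\<close>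

lemma pot_coboundary:
  assumes A: "A \<in> sets unit_borel" and g: "g > 1" and t: "0 \<le> t" "t \<le> 1"
  shows "pot g t A - pot g t (Tmap g -` A \<inter> {0..<1}) =
    measure unit_leb (A \<inter> {0..<t}) - t * measure unit_leb A"
proof -
  let ?w = "orbit g t" and ?l = "measure unit_leb"
  let ?a = "\<lambda>k. (1/g)^k * ?w k" and ?b = "\<lambda>k. (1/g)^k * ?l (A \<inter> {0..<?w k})"
  have w: "0 \<le> ?w k" "?w k \<le> 1" for k using orbit_bounds t by auto
  have sb: "summable ?b" by (rule pot_summable[OF g])
  have "summable (\<lambda>k. (1/g)^k * ?l {0..<?w k})" by (rule pot_summable[OF g])
  then have sa: "summable ?a" using w by (simp add: measure_unit_leb_Ico)
  have summand: "(1/g)^k * ?l ((Tmap g -` A \<inter> {0..<1}) \<inter> {0..<?w k}) =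
      ?l A * (?a k - ?a (Suc k)) + ?b (Suc k)" for k
  proof -
    have fl: "of_int \<lfloor>g * ?w k\<rfloor> = g * ?w k - ?w (Suc k)"
      by (simp add: orbit_Suc Tmap_def frac_def)
    show ?thesis
      using g by (subst Tmap_transfer[OF A _ w]) (simp_all add: fl orbit_Suc[symmetric] field_simps)
  qed
  have "pot g t (Tmap g -` A \<inter> {0..<1}) = (\<Sum>k. ?l A * (?a k - ?a (Suc k)) + ?b (Suc k))"
    unfolding pot_def summand ..
  also have "\<dots> = ?l A * ((\<Sum>k. ?a k) - (\<Sum>k. ?a (Suc k))) + (\<Sum>k. ?b (Suc k))"
  proof -
    have sa': "summable (\<lambda>k. ?a (Suc k))" and sb': "summable (\<lambda>k. ?b (Suc k))"
      using sa sb summable_Suc_iff[of ?a] summable_Suc_iff[of ?b] by simp_all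
    note d = summable_diff[OF sa sa']
    show ?thesis
      unfolding suminf_diff[OF sa sa'] suminf_mult[OF d, symmetric]
      by (rule suminf_add[OF summable_mult[OF d] sb', symmetric])
  qed
  also have "\<dots> = ?l A * t + pot g t A - ?b 0"
  proof -
    have "(\<Sum>k. ?a (Suc k)) = (\<Sum>k. ?a k) - t" "(\<Sum>k. ?b (Suc k)) = (\<Sum>k. ?b k) - ?b 0"
      using suminf_split_head[OF sa] suminf_split_head[OF sb] by simp_all
    then have "?l A * ((\<Sum>k. ?a k) - (\<Sum>k. ?a (Suc k))) + (\<Sum>k. ?b (Suc k)) = ?l A * t + (\<Sum>k. ?b k) - ?b 0"
      by (simp only:) argo
    then show ?thesis unfolding pot_def .
  qed
  finally show ?thesis by simp
qed


section \<open>Cesaro averages and uniqueness of the invariant measure\<close>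

definition preim :: "real \<Rightarrow> real set \<Rightarrow> nat \<Rightarrow> real set" where
  "preim g A k = ((\<lambda>B. Tmap g -` B \<inter> {0..<1}) ^^ k) A"

lemma preim_0 [simp]: "preim g A 0 = A"
  and preim_Suc: "preim g A (Suc k) = Tmap g -` preim g A k \<inter> {0..<1}"
  by (simp_all add: preim_def)

lemma preim_sets: "A \<in> sets unit_borel \<Longrightarrow> preim g A k \<in> sets unit_borel"
  by (induction k) (auto simp: preim_Suc)

text \<open>On \<open>[0,1)\<close> this is the Birkhoff average of the indicator of
  \<open>A\<close>: the share of times before \<open>N\<close> that the orbit of \<open>x\<close>
  spends in \<open>A\<close>.\<close>

definition avg :: "real \<Rightarrow> real set \<Rightarrow> nat \<Rightarrow> real \<Rightarrow> real" where
  "avg g A N x = (\<Sum>k<N. indicator (preim g A k) x) / real N"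

lemma avg_bounds: "0 \<le> avg g A N x" "avg g A N x \<le> 1"
proof -
  show "0 \<le> avg g A N x" unfolding avg_def by (auto intro!: divide_nonneg_nonneg sum_nonneg)
  have "(\<Sum>k<N. indicator (preim g A k) x) \<le> (\<Sum>k<N. 1::real)"
    by (intro sum_mono) (auto simp: indicator_def)
  then show "avg g A N x \<le> 1" unfolding avg_def by (auto simp: divide_le_eq_1)
qed

lemma avg_measurable:
  assumes "A \<in> sets unit_borel"
  shows "avg g A N \<in> borel_measurable unit_borel"
proof -
  have [measurable]: "preim g A k \<in> sets unit_borel" for k using assms by (rule preim_sets)
  show ?thesis unfolding avg_def[abs_def] by measurable
qed

lemma integrable_mult_avg:
  assumes A: "A \<in> sets unit_borel" and M: "sets M = sets unit_borel" and f: "integrable M f"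
  shows "integrable M (\<lambda>x. f x * avg g A N x)"
proof (rule Bochner_Integration.integrable_bound[OF f])
  have [measurable]: "avg g A N \<in> borel_measurable M"
    using avg_measurable[OF A] measurable_cong_sets[OF M refl] by blast
  have [measurable]: "f \<in> borel_measurable M" using f by auto
  show "(\<lambda>x. f x * avg g A N x) \<in> borel_measurable M" by measurable
  show "AE x in M. norm (f x * avg g A N x) \<le> norm (f x)"
    using avg_bounds[of g A N] by (auto simp: abs_mult intro!: mult_left_le)
qed

text \<open>The Lebesgue covariance of \<open>f\<close> with the Birkhoff average. If it tends to 0,
  the limiting average against \<open>f\<close> depends on \<open>f\<close> only through its
  integral.\<close>

definition discrep :: "real \<Rightarrow> real set \<Rightarrow> (real \<Rightarrow> real) \<Rightarrow> nat \<Rightarrow> real" where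
  "discrep g A f N = (\<integral>x. f x * avg g A N x \<partial>unit_leb) - (\<integral>x. f x \<partial>unit_leb) * (\<integral>x. avg g A N x \<partial>unit_leb)"

lemma integrable_avg:
  assumes A: "A \<in> sets unit_borel"
  shows "integrable unit_leb (avg g A N)"
  using integrable_mult_avg[OF A, of unit_leb "\<lambda>_. 1"] by simp

lemma discrep_add:
  assumes A: "A \<in> sets unit_borel" and f: "integrable unit_leb f" and h: "integrable unit_leb h"
  shows "discrep g A (\<lambda>x. f x + h x) N = discrep g A f N + discrep g A h N"
  using integrable_mult_avg[OF A _ f] integrable_mult_avg[OF A _ h] f h
  by (simp add: discrep_def algebra_simps)

lemma discrep_cmult: "discrep g A (\<lambda>x. c * f x) N = c * discrep g A f N"
  by (simp add: discrep_def algebra_simps)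

text \<open>Since the averages lie between 0 and 1, the functional is Lipschitz in the L1 norm,
  uniformly in \<open>N\<close>. This uniformity permits limits in \<open>f\<close>.\<close>

lemma discrep_bound:
  assumes A: "A \<in> sets unit_borel" and f: "integrable unit_leb f"
  shows "\<bar>discrep g A f N\<bar> \<le> 2 * (\<integral>x. \<bar>f x\<bar> \<partial>unit_leb)"
proof -
  have "\<bar>\<integral>x. f x * avg g A N x \<partial>unit_leb\<bar> \<le> (\<integral>x. \<bar>f x * avg g A N x\<bar> \<partial>unit_leb)"
    by (rule integral_abs_bound)
  also have "\<dots> \<le> (\<integral>x. \<bar>f x\<bar> \<partial>unit_leb)"
    using f avg_bounds[of g A N]
    by (intro integral_mono integrable_abs integrable_mult_avg[OF A]) (auto simp: abs_mult intro!: mult_left_le)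
  finally have 1: "\<bar>\<integral>x. f x * avg g A N x \<partial>unit_leb\<bar> \<le> (\<integral>x. \<bar>f x\<bar> \<partial>unit_leb)" .
  have "(\<integral>x. avg g A N x \<partial>unit_leb) \<le> (\<integral>x. 1 \<partial>unit_leb)"
    by (intro integral_mono integrable_avg[OF A]) (auto simp: avg_bounds)
  moreover have "0 \<le> (\<integral>x. avg g A N x \<partial>unit_leb)" by (simp add: avg_bounds)
  ultimately have "\<bar>(\<integral>x. f x \<partial>unit_leb) * (\<integral>x. avg g A N x \<partial>unit_leb)\<bar> \<le> \<bar>\<integral>x. f x \<partial>unit_leb\<bar> * 1"
    using unit_leb.prob_space unfolding abs_mult by (intro mult_left_mono) auto
  also have "\<dots> \<le> (\<integral>x. \<bar>f x\<bar> \<partial>unit_leb)" using integral_abs_bound[of unit_leb f] by simp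
  finally show ?thesis unfolding discrep_def using 1 by linarith
qed

text \<open>Dominated convergence gives L1 convergence, and \<open>discrep_bound\<close> lets one
  fix a good approximant \<open>s i\<close> before sending \<open>N\<close> to infinity. The factor
  2 in the bound is the one supplied by \<open>integrable_induct\<close>.\<close>

lemma discrep_closed:
  assumes A: "A \<in> sets unit_borel" and f: "integrable unit_leb f"
    and s: "\<And>i. integrable unit_leb (s i)" "\<And>i. discrep g A (s i) \<longlonglongrightarrow> 0"
    and lim: "\<And>x. x \<in> space unit_leb \<Longrightarrow> (\<lambda>i. s i x) \<longlonglongrightarrow> f x"
    and bound: "\<And>i x. x \<in> space unit_leb \<Longrightarrow> norm (s i x) \<le> 2 * norm (f x)"
  shows "discrep g A f \<longlonglongrightarrow> 0"
proof (rule LIMSEQ_I)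
  fix e :: real assume e: "e > 0"
  have "(\<lambda>i. \<integral>x. \<bar>f x - s i x\<bar> \<partial>unit_leb) \<longlonglongrightarrow> (\<integral>x. 0 \<partial>unit_leb)"
  \<comment> \<open>The majorant adds \<open>\<bar>f x\<bar>\<close> to the bound
    \<open>2 * \<bar>f x\<bar>\<close> on the approximants.\<close>
  proof (rule integral_dominated_convergence[where w = "\<lambda>x. 3 * \<bar>f x\<bar>"])
    show "AE x in unit_leb. (\<lambda>i. \<bar>f x - s i x\<bar>) \<longlonglongrightarrow> 0"
    proof (rule AE_I2)
      fix x assume "x \<in> space unit_leb"
      then have "(\<lambda>i. f x - s i x) \<longlonglongrightarrow> f x - f x" by (intro tendsto_intros lim)
      then show "(\<lambda>i. \<bar>f x - s i x\<bar>) \<longlonglongrightarrow> 0" by (simp add: tendsto_rabs_zero_iff)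
    qed
    show "AE x in unit_leb. norm \<bar>f x - s i x\<bar> \<le> 3 * \<bar>f x\<bar>" for i
      using bound[of _ i] by (intro AE_I2) (smt (verit) real_norm_def)
    show "integrable unit_leb (\<lambda>x. 3 * \<bar>f x\<bar>)" using f by auto
    show "(\<lambda>x. \<bar>f x - s i x\<bar>) \<in> borel_measurable unit_leb" for i
      using borel_measurable_integrable[OF f] borel_measurable_integrable[OF s(1)[of i]] by measurable
  qed simp
  then have "(\<lambda>i. \<integral>x. \<bar>f x - s i x\<bar> \<partial>unit_leb) \<longlonglongrightarrow> 0" by simp
  from LIMSEQ_D[OF this, of "e/4"] e obtain i where i: "(\<integral>x. \<bar>f x - s i x\<bar> \<partial>unit_leb) < e/4"
    by fastforce
  from LIMSEQ_D[OF s(2)[of i], of "e/2"] e obtain N0 where N0: "\<And>N. N \<ge> N0 \<Longrightarrow> \<bar>discrep g A (s i) N\<bar> < e/2"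
    by auto
  have "\<bar>discrep g A f N\<bar> < e" if "N \<ge> N0" for N
  proof -
    have d: "integrable unit_leb (\<lambda>x. f x - s i x)" using f s(1) by auto
    have "discrep g A f N = discrep g A (s i) N + discrep g A (\<lambda>x. f x - s i x) N"
      using discrep_add[OF A s(1)[of i] d] by simp
    then show ?thesis using N0[OF that] discrep_bound[OF A d, of g N] i by linarith
  qed
  then show "\<exists>N0. \<forall>N\<ge>N0. norm (discrep g A f N - 0) < e" by auto
qed

lemma integral_indicator_avg:
  assumes A: "A \<in> sets unit_borel" and S: "S \<in> sets unit_borel"
  shows "(\<integral>x. indicator S x * avg g A N x \<partial>unit_leb) = (\<Sum>k<N. measure unit_leb (preim g A k \<inter> S)) / N"
proof -
  have m: "preim g A k \<inter> S \<in> sets unit_leb" for k using preim_sets[OF A, of g k] S by auto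
  have "(\<integral>x. indicator S x * avg g A N x \<partial>unit_leb) = (\<integral>x. (\<Sum>k<N. indicator (preim g A k \<inter> S) x) / N \<partial>unit_leb)"
    unfolding avg_def by (intro Bochner_Integration.integral_cong) (auto simp: sum_distrib_left indicator_inter_arith mult.commute)
  also have "\<dots> = (\<Sum>k<N. \<integral>x. indicator (preim g A k \<inter> S) x \<partial>unit_leb) / N"
    using m by (simp add: Bochner_Integration.integral_sum unit_leb.emeasure_eq_measure)
  also have "\<dots> = (\<Sum>k<N. measure unit_leb (preim g A k \<inter> S)) / N"
    using m sets.sets_into_space[OF m] by (simp add: Int_absorb2)
  finally show ?thesis .
qed

text \<open>By \<open>pot_coboundary\<close>, applied to each iterated preimage, the sum of
  covariances telescopes to a difference of two values of \<open>pot\<close>. That difference is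
  bounded, so dividing by \<open>N\<close> sends it to 0.\<close>

lemma discrep_indicator_Ico:
  assumes A: "A \<in> sets unit_borel" and g: "g > 1" and t: "0 \<le> t" "t \<le> 1"
  shows "discrep g A (indicator {0..<t}) \<longlonglongrightarrow> 0"
proof -
  let ?l = "measure unit_leb"
  have eq: "discrep g A (indicator {0..<t}) N = (pot g t A - pot g t (preim g A N)) / N" for N
  proof -
    have "(\<integral>x. avg g A N x \<partial>unit_leb) = (\<integral>x. indicator {0..<1} x * avg g A N x \<partial>unit_leb)"
      by (intro Bochner_Integration.integral_cong) auto
    also have "\<dots> = (\<Sum>k<N. ?l (preim g A k \<inter> {0..<1})) / N"
      by (rule integral_indicator_avg[OF A]) simp
    also have "\<dots> = (\<Sum>k<N. ?l (preim g A k)) / N"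
      using preim_sets[OF A] by (auto simp: sets_unit_borel_iff Int_absorb2)
    finally have 1: "(\<integral>x. avg g A N x \<partial>unit_leb) = (\<Sum>k<N. ?l (preim g A k)) / N" .
    have "discrep g A (indicator {0..<t}) N = (\<Sum>k<N. ?l (preim g A k \<inter> {0..<t}) - t * ?l (preim g A k)) / N"
      using t unfolding discrep_def 1
      by (subst integral_indicator_avg[OF A])
        (auto simp: sum_subtractf sum_distrib_left diff_divide_distrib measure_unit_leb_Ico Int_absorb2)
    also have "(\<Sum>k<N. ?l (preim g A k \<inter> {0..<t}) - t * ?l (preim g A k)) =
        (\<Sum>k<N. pot g t (preim g A k) - pot g t (preim g A (Suc k)))"
      unfolding preim_Suc by (subst pot_coboundary[OF preim_sets[OF A] g t]) (rule refl)
    also have "\<dots> = pot g t A - pot g t (preim g A N)" by (subst sum_lessThan_telescope') simp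
    finally show ?thesis .
  qed
  show ?thesis
  proof (rule Lim_null_comparison)
    show "\<forall>\<^sub>F N in sequentially. norm (discrep g A (indicator {0..<t}) N) \<le> (g / (g - 1)) * (1 / real N)"
    proof (intro always_eventually allI)
      fix N
      have "\<bar>pot g t A - pot g t (preim g A N)\<bar> \<le> g / (g - 1)"
        using pot_bounds[OF g, of t A] pot_bounds[OF g, of t "preim g A N"] by linarith
      then have "\<bar>pot g t A - pot g t (preim g A N)\<bar> / N \<le> g / (g - 1) / N"
        by (rule divide_right_mono) simp
      then show "norm (discrep g A (indicator {0..<t}) N) \<le> (g / (g - 1)) * (1 / real N)"
        unfolding eq by simp
    qed
    show "(\<lambda>N. (g / (g - 1)) * (1 / real N)) \<longlonglongrightarrow> 0"
      by (rule tendsto_mult_right_zero[OF lim_1_over_n])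
  qed
qed

text \<open>A Dynkin system argument from the half-lines, which are closed under intersection. Borel
  measurability is carried through the induction because additivity of \<open>discrep\<close> needs
  integrability.\<close>

lemma discrep_indicator:
  assumes A: "A \<in> sets unit_borel" and g: "g > 1" and S: "S \<in> sets borel"
  shows "discrep g A (indicator S) \<longlonglongrightarrow> 0"
proof -
  have int: "integrable unit_leb (indicator X :: real \<Rightarrow> real)" if "X \<in> sets borel" for X
  proof -
    have "(\<lambda>x::real. indicator X x :: real) \<in> borel_measurable borel" using that by measurable
    then have [measurable]: "(indicator X :: real \<Rightarrow> real) \<in> borel_measurable unit_borel"
      unfolding unit_borel_def by (rule measurable_restrict_space1)
    show ?thesis
      by (rule unit_leb.integrable_const_bound[where B = 1]) (auto simp: indicator_def)
  qed
  have cong: "discrep g A f N = discrep g A h N" if "\<And>x. x \<in> {0..<1} \<Longrightarrow> f x = h x" for f h N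
    unfolding discrep_def using that
    by (metis (mono_tags, lifting) Bochner_Integration.integral_cong space_unit_leb)
  have S': "S \<in> sigma_sets UNIV (range lessThan)"
    using S unfolding borel_Iio by (subst (asm) sets_measure_of) auto
  have sub: "range (lessThan :: real \<Rightarrow> _) \<subseteq> Pow UNIV" by simp
  have stable: "Int_stable (range (lessThan :: real \<Rightarrow> _))"
  proof -
    have "{..<a} \<inter> {..<b} = {..<min a b}" for a b :: real by auto
    then show ?thesis unfolding Int_stable_def by blast
  qed
  have "S \<in> sets borel \<and> discrep g A (indicator S) \<longlonglongrightarrow> 0"
    using stable sub S'
  proof (induction rule: sigma_sets_induct_disjoint[where G = "range lessThan" and \<Omega> = UNIV])
    fix X assume "X \<in> range (lessThan :: real \<Rightarrow> _)"
    then obtain a where X: "X = {..<a}" by auto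
    \<comment> \<open>Integrals see only \<open>[0,1)\<close>, so the half-line may be replaced by
      an interval with its endpoint clamped to \<open>[0,1]\<close>.\<close>
    have "discrep g A (indicator X) = discrep g A (indicator {0..<max 0 (min a 1)})"
      unfolding X by (rule ext, rule cong) (auto simp: indicator_def)
    then show "X \<in> sets borel \<and> discrep g A (indicator X) \<longlonglongrightarrow> 0"
      using discrep_indicator_Ico[OF A g, of "max 0 (min a 1)"] X by auto
  next
    have "discrep g A (indicator {}) = (\<lambda>N. 0)" by (simp add: fun_eq_iff discrep_def)
    then show "{} \<in> sets borel \<and> discrep g A (indicator {}) \<longlonglongrightarrow> 0" by simp
  next
    fix X assume IH: "X \<in> sets borel \<and> discrep g A (indicator X) \<longlonglongrightarrow> 0"
    then have b: "X \<in> sets borel" "UNIV - X \<in> sets borel" by auto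
    have "discrep g A (indicator X) N + discrep g A (indicator (UNIV - X)) N = discrep g A (\<lambda>x. 1) N" for N
    proof -
      have "(\<lambda>x. indicator X x + indicator (UNIV - X) x :: real) = (\<lambda>x. 1)"
        by (auto simp: fun_eq_iff indicator_def)
      then show ?thesis
        using discrep_add[OF A int[OF b(1)] int[OF b(2)], of g N] by metis
    qed
    moreover have "discrep g A (\<lambda>x. 1) N = 0" for N
      using unit_leb.prob_space by (simp add: discrep_def)
    ultimately have "discrep g A (indicator (UNIV - X)) = (\<lambda>N. - discrep g A (indicator X) N)"
      by (auto simp: fun_eq_iff algebra_simps add_eq_0_iff)
    then show "UNIV - X \<in> sets borel \<and> discrep g A (indicator (UNIV - X)) \<longlonglongrightarrow> 0"
      using IH b tendsto_minus[of "discrep g A (indicator X)" 0] by auto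
  next
    fix X :: "nat \<Rightarrow> real set"
    assume disj: "disjoint_family X"
      and IH: "\<And>i. X i \<in> sets borel \<and> discrep g A (indicator (X i)) \<longlonglongrightarrow> 0"
    then have b: "X i \<in> sets borel" for i by auto
    define U where "U = (\<lambda>n. \<Union>i<n. X i)"
    have U: "U n \<in> sets borel" for n unfolding U_def using b by auto
    have lim: "discrep g A (indicator (U n)) \<longlonglongrightarrow> 0" for n
    proof (induction n)
      case 0 show ?case by (simp add: U_def discrep_def)
    next
      case (Suc n)
      have "X n \<inter> U n = {}" using disj unfolding U_def disjoint_family_on_def
        by (auto, metis UNIV_I disjoint_iff less_irrefl)
      then have "(indicator (U (Suc n)) :: real \<Rightarrow> real) = (\<lambda>x. indicator (U n) x + indicator (X n) x)"
        by (auto simp: U_def lessThan_Suc indicator_def fun_eq_iff)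
      then have eq: "discrep g A (indicator (U (Suc n))) = (\<lambda>N. discrep g A (indicator (U n)) N + discrep g A (indicator (X n)) N)"
        by (simp only:) (rule ext, rule discrep_add[OF A int[OF U] int[OF b]])
      show ?case unfolding eq using tendsto_add[OF Suc conjunct2[OF IH[of n]]] by simp
    qed
    have "discrep g A (indicator (\<Union>(range X))) \<longlonglongrightarrow> 0"
    proof (rule discrep_closed[OF A _ _ lim])
      show "(\<lambda>n. indicator (U n) x :: real) \<longlonglongrightarrow> indicator (\<Union>(range X)) x" for x
        unfolding U_def by (rule LIMSEQ_indicator_UN)
      show "norm (indicator (U n) x :: real) \<le> 2 * norm (indicator (\<Union>(range X)) x :: real)" for n x
        by (auto simp: U_def indicator_def)
      show "integrable unit_leb (indicator (\<Union>(range X)) :: real \<Rightarrow> real)"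
        using b by (intro int) auto
      show "integrable unit_leb (indicator (U n) :: real \<Rightarrow> real)" for n
        by (intro int U)
    qed
    then show "\<Union>(range X) \<in> sets borel \<and> discrep g A (indicator (\<Union>(range X))) \<longlonglongrightarrow> 0"
      using b by auto
  qed
  then show ?thesis ..
qed

lemma discrep_tendsto_0:
  assumes A: "A \<in> sets unit_borel" and g: "g > 1" and f: "integrable unit_leb f"
  shows "discrep g A f \<longlonglongrightarrow> 0"
  using f
proof (induction rule: integrable_induct)
  case (base S c)
  then have "S \<in> sets borel" by (simp add: sets_unit_borel_iff)
  from discrep_indicator[OF A g this]
  have "(\<lambda>N. c * discrep g A (indicator S) N) \<longlonglongrightarrow> 0" by (rule tendsto_mult_right_zero)
  then show ?case unfolding discrep_cmult[symmetric] by (simp add: mult.commute)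
next
  case (add f h)
  then show ?case using tendsto_add[OF add(3,4)] by (simp add: discrep_add[OF A])
next
  case (lim f s)
  show ?case
    by (rule discrep_closed[OF A, where s = s and f = f]) (use lim in blast)+
qed

text \<open>Invariance makes the average against the density of \<open>M\<close> equal to
  \<open>measure M A\<close> for every positive \<open>N\<close>, and the vanishing covariance
  replaces that density by the constant 1. The sequence does not mention \<open>M\<close>, which is
  what yields uniqueness.\<close>

lemma invariant_measure_tendsto:
  assumes g: "g > 1" and P: "prob_space M" and sets: "sets M = sets unit_borel"
    and ac: "absolutely_continuous unit_leb M" and inv: "distr M unit_borel (Tmap g) = M"
    and A: "A \<in> sets unit_borel"
  shows "(\<lambda>N. \<integral>x. avg g A N x \<partial>unit_leb) \<longlonglongrightarrow> measure M A"
proof -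
  interpret M: prob_space M by fact
  have sp: "space M = {0..<1}" using sets_eq_imp_space_eq[OF sets] by simp
  have Tm: "Tmap g \<in> M \<rightarrow>\<^sub>M unit_borel" using measurable_cong_sets[OF sets refl, of unit_borel] Tmap_measurable by blast
  \<comment> \<open>A real-valued version of the Radon-Nikodym derivative is needed, because
    \<open>discrep\<close> takes real integrands.\<close>
  obtain D where D: "D \<in> borel_measurable unit_leb" "AE x in unit_leb. RN_deriv unit_leb M x = ennreal (D x)"
    "AE x in M. 0 < D x" "\<And>x. 0 \<le> D x"
    using unit_leb.real_RN_deriv[OF _ ac] sets M.finite_measure_axioms by auto
  have "M = density unit_leb (RN_deriv unit_leb M)"
    using unit_leb.density_RN_deriv[OF ac] sets by simp
  also have "\<dots> = density unit_leb D"
    using D by (intro density_cong) auto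
  finally have M: "M = density unit_leb D" .
  have D0: "AE x in unit_leb. 0 \<le> D x" using D(4) by simp
  have "integrable (density unit_leb D) (\<lambda>_. 1::real)" unfolding M[symmetric] by simp
  then have Dint: "integrable unit_leb D"
    by (subst (asm) integrable_density[OF _ D(1) D0]) auto
  have D1: "(\<integral>x. D x \<partial>unit_leb) = 1"
    using integral_density[OF _ D(1) D0, of "\<lambda>_. 1::real"] M.prob_space
    unfolding M[symmetric] by simp
  have mpre: "measure M (preim g A k) = measure M A" for k
  proof (induction k)
    case (Suc k)
    have "measure M (preim g A k) = measure M (Tmap g -` preim g A k \<inter> space M)"
      using preim_sets[OF A] by (subst inv[symmetric]) (rule measure_distr[OF Tm])
    then show ?case using Suc by (simp add: preim_Suc sp)
  qed simp
  have "(\<integral>x. D x * avg g A N x \<partial>unit_leb) = measure M A" if "N > 0" for N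
  proof -
    have "(\<integral>x. D x * avg g A N x \<partial>unit_leb) = (\<integral>x. avg g A N x \<partial>M)"
      using integral_density[OF _ D(1) D0, of "avg g A N"] avg_measurable[OF A, of g N]
      unfolding M[symmetric] by simp
    also have "\<dots> = (\<Sum>k<N. \<integral>x. indicator (preim g A k) x \<partial>M) / N"
      unfolding avg_def using preim_sets[OF A, of g] sets
      by (subst Bochner_Integration.integral_divide_zero, subst Bochner_Integration.integral_sum)
        (auto simp: M.emeasure_eq_measure)
    also have "\<dots> = (\<Sum>k<N. measure M A) / N"
      using preim_sets[OF A, of g] sets sets.sets_into_space[OF preim_sets[OF A, of g]]
      by (auto simp: sp Int_absorb2 mpre)
    finally show ?thesis using that by simp
  qed
  \<comment> \<open>At \<open>N = 0\<close> the average is 0 by the convention for division by zero,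
    so the identity starts at \<open>N = 1\<close>.\<close>
  then have "\<forall>\<^sub>F N in sequentially. measure M A - discrep g A D N = (\<integral>x. avg g A N x \<partial>unit_leb)"
    by (intro eventually_sequentiallyI[of 1]) (simp add: discrep_def D1)
  moreover have "(\<lambda>N. measure M A - discrep g A D N) \<longlonglongrightarrow> measure M A - 0"
    by (intro tendsto_intros discrep_tendsto_0[OF A g Dint])
  ultimately show ?thesis using tendsto_cong by fastforce
qed

lemma invariant_measure_unique:
  assumes "g > 1"
    and "prob_space M" "sets M = sets unit_borel" "absolutely_continuous unit_leb M" "distr M unit_borel (Tmap g) = M"
    and "prob_space N" "sets N = sets unit_borel" "absolutely_continuous unit_leb N" "distr N unit_borel (Tmap g) = N"
  shows "M = N"
proof (rule measure_eqI)
  interpret M: prob_space M by fact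
  interpret N: prob_space N by fact
  show "sets M = sets N" using assms by simp
  fix A assume "A \<in> sets M"
  then have "measure M A = measure N A"
    using invariant_measure_tendsto[of g M A] invariant_measure_tendsto[of g N A] assms LIMSEQ_unique by metis
  then show "emeasure M A = emeasure N A" by (simp add: M.emeasure_eq_measure N.emeasure_eq_measure)
qed


section \<open>Parry's measure: existence of the invariant measure\<close>

definition parry :: "real \<Rightarrow> real measure" where
  "parry g = density unit_leb
     (\<lambda>x. \<Sum>k. ennreal ((1/g)^k / pot g 1 {0..<1}) * indicator {0..<orbit g 1 k} x)"

lemma parry_density_measurable:
  "(\<lambda>x. \<Sum>k. ennreal ((1/g)^k / c) * indicator {0..<orbit g 1 k} x) \<in> borel_measurable unit_leb"
  by (intro borel_measurable_suminf_order borel_measurable_times_ennreal measurable_const borel_measurable_indicator)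
    (auto simp: orbit_bounds)

lemma sets_parry [simp]: "sets (parry g) = sets unit_borel"
  by (simp add: parry_def)

lemma pot_unit_ge_1: "g > 1 \<Longrightarrow> pot g 1 {0..<1} \<ge> 1"
  using sum_le_suminf[OF pot_summable, of g "{0}" "\<lambda>k. {0..<1} \<inter> {0..<orbit g 1 k}"]
  by (simp add: pot_def measure_unit_leb_Ico)

lemma emeasure_parry:
  assumes g: "g > 1" and A: "A \<in> sets unit_borel"
  shows "emeasure (parry g) A = ennreal (pot g 1 A / pot g 1 {0..<1})"
proof -
  let ?c = "pot g 1 {0..<1}" and ?I = "\<lambda>k. {0..<orbit g 1 k}"
  have c: "?c > 0" using pot_unit_ge_1[OF g] by simp
  have I [measurable]: "?I k \<in> sets unit_borel" for k by (simp add: orbit_bounds)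
  have "emeasure (parry g) A = (\<integral>\<^sup>+x. (\<Sum>k. ennreal ((1/g)^k / ?c) * indicator (?I k) x) * indicator A x \<partial>unit_leb)"
    unfolding parry_def using A by (intro emeasure_density parry_density_measurable) auto
  also have "\<dots> = (\<integral>\<^sup>+x. (\<Sum>k. ennreal ((1/g)^k / ?c) * indicator (A \<inter> ?I k) x) \<partial>unit_leb)"
    by (intro nn_integral_cong) (simp add: ennreal_suminf_multc[symmetric] indicator_inter_arith mult_ac)
  also have "\<dots> = (\<Sum>k. \<integral>\<^sup>+x. ennreal ((1/g)^k / ?c) * indicator (A \<inter> ?I k) x \<partial>unit_leb)"
    using A I by (intro nn_integral_suminf borel_measurable_times_ennreal measurable_const borel_measurable_indicator) auto
  also have "\<dots> = (\<Sum>k. ennreal ((1/g)^k / ?c) * emeasure unit_leb (A \<inter> ?I k))"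
    using A I by (subst nn_integral_cmult_indicator) auto
  also have "\<dots> = (\<Sum>k. ennreal ((1/g)^k * measure unit_leb (A \<inter> ?I k) / ?c))"
    using g c by (simp add: unit_leb.emeasure_eq_measure ennreal_mult'[symmetric] field_simps)
  also have "\<dots> = ennreal (\<Sum>k. (1/g)^k * measure unit_leb (A \<inter> ?I k) / ?c)"
    using g c by (intro suminf_ennreal2 summable_divide pot_summable) auto
  also have "(\<Sum>k. (1/g)^k * measure unit_leb (A \<inter> ?I k) / ?c) = pot g 1 A / ?c"
    unfolding pot_def using g by (intro suminf_divide pot_summable)
  finally show ?thesis .
qed

lemma measure_parry:
  assumes g: "g > 1" and A: "A \<in> sets unit_borel"
  shows "measure (parry g) A = pot g 1 A / pot g 1 {0..<1}"
  using emeasure_parry[OF assms] pot_bounds(1)[OF g, of 1] pot_unit_ge_1[OF g]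
  by (simp add: measure_def)

lemma prob_space_parry:
  assumes g: "g > 1" shows "prob_space (parry g)"
proof
  have "space (parry g) = {0..<1}" by (simp add: parry_def)
  then show "emeasure (parry g) (space (parry g)) = 1"
    using emeasure_parry[OF g, of "{0..<1}"] pot_unit_ge_1[OF g] by simp
qed

lemma absolutely_continuous_parry: "absolutely_continuous unit_leb (parry g)"
  unfolding parry_def by (intro absolutely_continuousI_density parry_density_measurable)

lemma measurable_Tmap_sets [simp]: "sets M = sets unit_borel \<Longrightarrow> Tmap g \<in> M \<rightarrow>\<^sub>M unit_borel"
  using measurable_cong_sets[of M unit_borel unit_borel unit_borel] Tmap_measurable by blast

text \<open>For \<open>t = 1\<close> the right side of the coboundary identity is zero, so
  \<open>pot g 1\<close> takes the same value on \<open>A\<close> and on its preimage.\<close>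

lemma distr_parry:
  assumes g: "g > 1" shows "distr (parry g) unit_borel (Tmap g) = parry g"
proof (rule measure_eqI)
  fix A assume "A \<in> sets (distr (parry g) unit_borel (Tmap g))"
  then have A: "A \<in> sets unit_borel" by simp
  have "A \<inter> {0..<1} = A" using A by (auto simp: sets_unit_borel_iff)
  then have "pot g 1 (Tmap g -` A \<inter> {0..<1}) = pot g 1 A"
    using pot_coboundary[OF A g, of 1] by simp
  moreover have "space (parry g) = {0..<1}" by (simp add: parry_def)
  ultimately show "emeasure (distr (parry g) unit_borel (Tmap g)) A = emeasure (parry g) A"
    using A g by (simp add: emeasure_distr emeasure_parry)
qed simp

text \<open>This writes the distribution function as a series of functions \<open>min t w\<close>,
  each with a single kink at an orbit point.\<close>

lemma measure_parry_Ico: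
  assumes g: "g > 1" and t: "0 \<le> t" "t \<le> 1"
  shows "measure (parry g) {0..<t} = (\<Sum>k. (1/g)^k * min t (orbit g 1 k)) / pot g 1 {0..<1}"
proof -
  have "measure unit_leb ({0..<t} \<inter> {0..<orbit g 1 k}) = min t (orbit g 1 k)" for k
  proof -
    have "{0..<t} \<inter> {0..<orbit g 1 k} = {0..<min t (orbit g 1 k)}" by auto
    then show ?thesis using t orbit_bounds[of 1 g k] by (simp add: measure_unit_leb_Ico)
  qed
  then show ?thesis using t by (simp add: measure_parry[OF g] pot_def)
qed

section \<open>Pushforwards, compositions and the two components of \<open>alt_acim\<close>\<close>

lemma absolutely_continuous_distr_Tmap:
  assumes ac: "absolutely_continuous unit_leb M" and M: "sets M = sets unit_borel" and g: "g > 0"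
  shows "absolutely_continuous unit_leb (distr M unit_borel (Tmap g))"
  unfolding absolutely_continuous_def
proof
  fix A assume "A \<in> null_sets unit_leb"
  then have A: "A \<in> sets unit_borel" "measure unit_leb A = 0" by (auto simp: null_sets_def measure_def)
  have sp: "space M = {0..<1}" using sets_eq_imp_space_eq[OF M] by simp
  have "A \<inter> {0..<Tmap g 1} \<in> sets unit_borel" using A(1) Ico_in_sets[of "Tmap g 1"] by (intro sets.Int) (simp_all add: less_imp_le)
  then have "measure unit_leb (A \<inter> {0..<Tmap g 1}) \<le> measure unit_leb A"
    using A by (intro unit_leb.finite_measure_mono) auto
  then have 0: "measure unit_leb (A \<inter> {0..<Tmap g 1}) = 0" using A measure_nonneg[of unit_leb] by (simp add: antisym)
  \<comment> \<open>The choice \<open>s = 1\<close> covers all branches, and each contributes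
    measure zero.\<close>
  have "measure unit_leb ((Tmap g -` A \<inter> {0..<1}) \<inter> {0..<1}) = 0"
    by (subst Tmap_transfer[OF A(1) g]) (simp_all add: A 0)
  then have "Tmap g -` A \<inter> {0..<1} \<in> null_sets unit_leb"
    using A by (simp add: null_sets_def unit_leb.emeasure_eq_measure)
  then have "Tmap g -` A \<inter> {0..<1} \<in> null_sets M" using ac by (auto simp: absolutely_continuous_def)
  then show "A \<in> null_sets (distr M unit_borel (Tmap g))"
    using A M by (simp add: null_sets_def emeasure_distr sp)
qed

text \<open>The integer part removed by the inner map is multiplied by the integer \<open>n\<close>,
  hence invisible to the outer fractional part. The argument needs the integer factor on the
  outside.\<close>

lemma Tmap_nat_comp: "Tmap (real n) \<circ> Tmap b = Tmap (real n * b)"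
proof
  fix x
  have shift: "frac (y - of_int k) = frac y" for y :: real and k by (simp add: frac_def)
  have "real n * frac (b * x) = real n * b * x - of_int (int n * \<lfloor>b * x\<rfloor>)"
    by (simp add: frac_def algebra_simps)
  then show "(Tmap (real n) \<circ> Tmap b) x = Tmap (real n * b) x"
    unfolding Tmap_def comp_def by (simp only: shift)
qed

text \<open>\<open>measure_of\<close> falls back to the zero measure unless the given set function
  is a measure, so countable additivity has to be checked. It is inherited through the two slices of
  a set, which are measurable and preserve disjointness.\<close>

lemma emeasure_alt_acim:
  assumes s: "sets (acim (real n) b) = sets unit_borel" "sets (acim b (real n)) = sets unit_borel"
    and S: "S \<in> sets alt_space"
  shows "emeasure (alt_acim b n) S = ennreal (1/2) * emeasure (acim (real n) b) {x. (False, x) \<in> S}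
        + ennreal (1/2) * emeasure (acim b (real n)) {x. (True, x) \<in> S}"
proof (rule emeasure_measure_of[OF alt_acim_def])
  show "sets alt_space \<subseteq> Pow (space alt_space)" by (rule sets.space_closed)
  show "S \<in> sets (alt_acim b n)" using S by (simp add: alt_acim_def sets.space_closed sets.sigma_sets_eq)
  let ?f = "\<lambda>S. ennreal (1/2) * emeasure (acim (real n) b) {x. (False, x) \<in> S}
        + ennreal (1/2) * emeasure (acim b (real n)) {x. (True, x) \<in> S}"
  show "positive (sets (alt_acim b n)) ?f" by (simp add: positive_def)
  show "countably_additive (sets (alt_acim b n)) ?f"
  proof (rule countably_additiveI)
    fix X :: "nat \<Rightarrow> (bool \<times> real) set"
    assume X: "range X \<subseteq> sets (alt_acim b n)" and disj: "disjoint_family X"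
    have Xi: "X i \<in> sets alt_space" for i
      using X by (auto simp: alt_acim_def sets.space_closed sets.sigma_sets_eq)
    have slice: "{x. (c, x) \<in> X i} \<in> sets unit_borel" for c i
      using sets_Pair1[OF Xi[of i, unfolded alt_space_def], of c] by (simp add: vimage_def)
    have add: "(\<Sum>i. emeasure M {x. (c, x) \<in> X i}) = emeasure M {x. (c, x) \<in> \<Union>(range X)}"
      if "sets M = sets unit_borel" for M c
    proof -
      have "{x. (c, x) \<in> \<Union>(range X)} = (\<Union>i. {x. (c, x) \<in> X i})" by auto
      moreover have "disjoint_family (\<lambda>i. {x. (c, x) \<in> X i})"
        using disj by (fastforce simp: disjoint_family_on_def)
      ultimately show ?thesis using slice that by (simp add: suminf_emeasure image_subset_iff)
    qed
    show "(\<Sum>i. ?f (X i)) = ?f (\<Union>(range X))"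
      by (subst suminf_add[symmetric]) (simp_all only: summableI ennreal_suminf_cmult add[OF s(1)] add[OF s(2)])
  qed
qed

text \<open>Testing on \<open>{False} \<times> A\<close> and \<open>{True} \<times> A\<close>
  isolates one component, and the factor 1/2 cancels.\<close>

lemma alt_acim_eqD:
  assumes s: "sets (acim (real n) b) = sets unit_borel" "sets (acim b (real n)) = sets unit_borel"
    and s': "sets (acim (real n) b') = sets unit_borel" "sets (acim b' (real n)) = sets unit_borel"
    and eq: "alt_acim b n = alt_acim b' n"
  shows "acim (real n) b = acim (real n) b'" and "acim b (real n) = acim b' (real n)"
proof -
  have half: "ennreal (1/2) * x = ennreal (1/2) * y \<longleftrightarrow> x = y" for x y
    by (simp add: ennreal_mult_cancel_left)
  have prod: "{c} \<times> A \<in> sets alt_space" if "A \<in> sets unit_borel" for c A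
    unfolding alt_space_def using that by (intro pair_measureI) auto
  show "acim (real n) b = acim (real n) b'"
  proof (rule measure_eqI)
    fix A assume "A \<in> sets (acim (real n) b)"
    then have "{False} \<times> A \<in> sets alt_space" using s prod by auto
    from emeasure_alt_acim[OF s this] emeasure_alt_acim[OF s' this] eq
    show "emeasure (acim (real n) b) A = emeasure (acim (real n) b') A" by - (rule half[THEN iffD1], simp)
  qed (simp add: s s')
  show "acim b (real n) = acim b' (real n)"
  proof (rule measure_eqI)
    fix A assume "A \<in> sets (acim b (real n))"
    then have "{True} \<times> A \<in> sets alt_space" using s prod by auto
    from emeasure_alt_acim[OF s this] emeasure_alt_acim[OF s' this] eq
    show "emeasure (acim b (real n)) A = emeasure (acim b' (real n)) A" by - (rule half[THEN iffD1], simp)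
  qed (simp add: s s')
qed


section \<open>Kinks of series of minima, read as point masses\<close>

definition kink :: "(nat \<Rightarrow> real) \<Rightarrow> (nat \<Rightarrow> real) \<Rightarrow> real \<Rightarrow> real" where
  "kink a u x = (\<Sum>k. a k * of_bool (u k = x))"

lemma second_difference_min_bound:
  fixes x w e :: real
  shows "\<bar>2 * min x w - min (x - e) w - min (x + e) w\<bar> \<le> \<bar>e\<bar>"
  by (auto simp: min_def abs_real_def)

text \<open>The second difference equals \<open>e\<close> when \<open>w = x\<close>, and it vanishes
  once \<open>e\<close> is below the distance from \<open>x\<close> to \<open>w\<close>. So the
  quotient is eventually constant.\<close>

lemma second_difference_min_tendsto:
  fixes x w :: real
  shows "((\<lambda>e. (2 * min x w - min (x - e) w - min (x + e) w) / e) \<longlongrightarrow> of_bool (w = x)) (at_right 0)"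
proof (rule tendsto_eventually)
  define d where "d = (if w = x then 1 else \<bar>w - x\<bar>)"
  have "d > 0" by (simp add: d_def)
  then have "\<forall>\<^sub>F e in at_right 0. e \<in> {0<..<d}" by (rule eventually_at_right_real)
  then show "\<forall>\<^sub>F e in at_right 0. (2 * min x w - min (x - e) w - min (x + e) w) / e = of_bool (w = x)"
    by eventually_elim (auto simp: d_def min_def abs_real_def split: if_splits)
qed

text \<open>The function \<open>t \<mapsto> A t + \<Sum>\<^sub>k a\<^sub>k min(t, u\<^sub>k)\<close> loses slope \<open>kink a u x\<close> at \<open>x\<close>,
  so its values on an interval determine the kinks there.\<close>

lemma kink_tendsto:
  fixes a u :: "nat \<Rightarrow> real" and A x :: real
  assumes a: "summable (\<lambda>k. \<bar>a k\<bar>)"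
    and S: "\<And>t. summable (\<lambda>k. a k * min t (u k))"
  defines "\<Phi> \<equiv> \<lambda>t. A * t + (\<Sum>k. a k * min t (u k))"
  shows "((\<lambda>e. (2 * \<Phi> x - \<Phi> (x - e) - \<Phi> (x + e)) / e) \<longlongrightarrow> kink a u x) (at_right 0)"
proof -
  let ?q = "\<lambda>w e. (2 * min x w - min (x - e) w - min (x + e) w) / e"
  have "((\<lambda>e. \<Sum>k. a k * ?q (u k) e) \<longlongrightarrow> kink a u x) (at_right 0)"
    unfolding kink_def
  \<comment> \<open>Limit and sum may be exchanged because every quotient is at most 1 in absolute
    value, which makes \<open>\<bar>a k\<bar>\<close> a summable majorant.\<close>
  proof (rule tannerys_theorem[THEN conjunct2, THEN conjunct2])
    show "((\<lambda>e. a k * ?q (u k) e) \<longlongrightarrow> a k * of_bool (u k = x)) (at_right 0)" for k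
      by (intro tendsto_mult_left second_difference_min_tendsto)
    have "norm (a k * ?q (u k) e) \<le> \<bar>a k\<bar>" for k e
    proof -
      have "\<bar>?q (u k) e\<bar> \<le> 1"
        using second_difference_min_bound[of x "u k" e] by (simp add: abs_divide divide_le_eq_1)
      then show ?thesis by (simp only: real_norm_def abs_mult mult_left_le abs_ge_zero)
    qed
    then show "\<forall>\<^sub>F (k, e) in at_top \<times>\<^sub>F at_right 0. norm (a k * ?q (u k) e) \<le> \<bar>a k\<bar>"
      by (intro always_eventually) auto
  qed (use a in auto)
  moreover have "(\<Sum>k. a k * ?q (u k) e) = (2 * \<Phi> x - \<Phi> (x - e) - \<Phi> (x + e)) / e" for e
  proof -
    let ?S = "\<lambda>t. (\<Sum>k. a k * min t (u k))"
    have "(\<lambda>k. a k * min t (u k)) sums ?S t" for t using S by (rule summable_sums)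
    then have "(\<lambda>k. (2 * (a k * min x (u k)) - a k * min (x - e) (u k) - a k * min (x + e) (u k)) / e)
        sums ((2 * ?S x - ?S (x - e) - ?S (x + e)) / e)"
      by (intro sums_divide sums_diff sums_mult)
    moreover have "(2 * (a k * min x (u k)) - a k * min (x - e) (u k) - a k * min (x + e) (u k)) / e = a k * ?q (u k) e" for k
      by (simp add: algebra_simps)
    moreover have "(2 * ?S x - ?S (x - e) - ?S (x + e)) / e = (2 * \<Phi> x - \<Phi> (x - e) - \<Phi> (x + e)) / e"
      by (simp add: \<Phi>_def algebra_simps)
    ultimately show ?thesis by (simp only: sums_iff)
  qed
  ultimately show ?thesis by simp
qed

lemma summable_min:
  fixes a u :: "nat \<Rightarrow> real"
  assumes a: "summable (\<lambda>k. \<bar>a k\<bar>)" and u: "\<And>k. 0 \<le> u k" "\<And>k. u k \<le> 1"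
  shows "summable (\<lambda>k. a k * min t (u k))"
proof (rule summable_comparison_test')
  show "summable (\<lambda>k. \<bar>a k\<bar> * (\<bar>t\<bar> + 1))" using a by (rule summable_mult2)
  show "norm (a k * min t (u k)) \<le> \<bar>a k\<bar> * (\<bar>t\<bar> + 1)" if "k \<ge> 0" for k
    unfolding real_norm_def abs_mult
    using u[of k] by (intro mult_left_mono) (auto simp: min_def)
qed

text \<open>Second differences kill linear terms, so the slopes \<open>A\<close> and
  \<open>B\<close> may differ. Agreement on a neighbourhood of \<open>x\<close> suffices, as the
  limit involves only small \<open>e\<close>.\<close>

lemma kink_eqI:
  assumes a: "summable (\<lambda>k. \<bar>a k\<bar>)" and u: "\<And>k. 0 \<le> u k" "\<And>k. u k \<le> 1"
    and b: "summable (\<lambda>k. \<bar>b k\<bar>)" and v: "\<And>k. 0 \<le> v k" "\<And>k. v k \<le> 1"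
    and x: "l < x" "x < r"
    and eq: "\<And>t. l < t \<Longrightarrow> t < r \<Longrightarrow>
      A * t + (\<Sum>k. a k * min t (u k)) = B * t + (\<Sum>k. b k * min t (v k))"
  shows "kink a u x = kink b v x"
proof -
  define F where "F = (\<lambda>t. A * t + (\<Sum>k. a k * min t (u k)))"
  define G where "G = (\<lambda>t. B * t + (\<Sum>k. b k * min t (v k)))"
  have FG: "F t = G t" if "l < t" "t < r" for t using eq[OF that] by (simp add: F_def G_def)
  have F: "((\<lambda>e. (2 * F x - F (x - e) - F (x + e)) / e) \<longlongrightarrow> kink a u x) (at_right 0)"
    unfolding F_def by (intro kink_tendsto a summable_min u)
  have G: "((\<lambda>e. (2 * G x - G (x - e) - G (x + e)) / e) \<longlongrightarrow> kink b v x) (at_right 0)"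
    unfolding G_def by (intro kink_tendsto b summable_min v)
  have "0 < min (x - l) (r - x)" using x by simp
  then have "\<forall>\<^sub>F e in at_right 0. e \<in> {0<..<min (x - l) (r - x)}" by (rule eventually_at_right_real)
  then have "\<forall>\<^sub>F e in at_right 0. (2 * F x - F (x - e) - F (x + e)) / e = (2 * G x - G (x - e) - G (x + e)) / e"
    by eventually_elim (use x in \<open>simp add: FG\<close>)
  from tendsto_cong[OF this] F have "((\<lambda>e. (2 * G x - G (x - e) - G (x + e)) / e) \<longlongrightarrow> kink a u x) (at_right 0)"
    by simp
  then show ?thesis using G by (rule tendsto_unique[rotated]) simp
qed

section \<open>Atoms of the orbit of 1 and comparison of two slopes\<close>

abbreviation atom :: "real \<Rightarrow> real \<Rightarrow> real" where
  "atom g \<equiv> kink (\<lambda>k. (1/g)^k) (orbit g 1)"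

lemma summable_atom:
  fixes g :: real
  shows "g > 1 \<Longrightarrow> summable (\<lambda>k. (1/g)^k * of_bool (P k))"
  by (rule summable_comparison_test'[of "\<lambda>k. (1/g)^k"]) (auto simp: summable_geometric)

lemma orbit_1 [simp]: "orbit g 1 (Suc 0) = frac g"
  by (simp add: orbit_Suc Tmap_def)

lemma orbit_Suc_less_1: "orbit g t (Suc k) < 1"
  by (simp add: orbit_Suc)

lemma atom_ge_term:
  assumes "g > 1" "orbit g 1 k = x"
  shows "(1/g)^k \<le> atom g x"
proof -
  have "(\<Sum>k\<in>{k}. (1/g)^k * of_bool (orbit g 1 k = x)) \<le> atom g x"
    unfolding kink_def using assms(1) by (intro sum_le_suminf summable_atom) auto
  then show ?thesis using assms(2) by simp
qed

lemma atom_ge_two_terms: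
  assumes "g > 1" "orbit g 1 k = x" "orbit g 1 j = x" "k \<noteq> j"
  shows "(1/g)^k + (1/g)^j \<le> atom g x"
proof -
  have "(\<Sum>k\<in>{k,j}. (1/g)^k * of_bool (orbit g 1 k = x)) \<le> atom g x"
    unfolding kink_def using assms(1) by (intro sum_le_suminf summable_atom) auto
  then show ?thesis using assms by simp
qed

text \<open>The geometric tail from \<open>m\<close> on is shared between the times at which the
  orbit hits \<open>x\<close> and those at which it misses; the first \<open>m\<close> times all
  miss.\<close>

lemma atom_split:
  assumes "g > 1" and J: "\<And>k. k < m \<Longrightarrow> orbit g 1 k \<noteq> x"
  shows "atom g x + (\<Sum>k. (1/g)^k * of_bool (k \<ge> m \<and> orbit g 1 k \<noteq> x)) = (1/g)^m * g / (g - 1)"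
proof -
  have "atom g x + (\<Sum>k. (1/g)^k * of_bool (k \<ge> m \<and> orbit g 1 k \<noteq> x)) =
      (\<Sum>k. (1/g)^k * of_bool (orbit g 1 k = x) + (1/g)^k * of_bool (k \<ge> m \<and> orbit g 1 k \<noteq> x))"
    unfolding kink_def by (intro suminf_add summable_atom assms)
  also have "(\<lambda>k. (1/g)^k * of_bool (orbit g 1 k = x) + (1/g)^k * of_bool (k \<ge> m \<and> orbit g 1 k \<noteq> x))
      = (\<lambda>k. (1/g)^k * of_bool (k \<ge> m))"
    using J by (auto simp: fun_eq_iff not_less[symmetric])
  also have "(\<Sum>k. (1/g)^k * of_bool (k \<ge> m)) = (\<Sum>k. (1/g)^(k + m) * of_bool (k + m \<ge> m)) + (\<Sum>k<m. (1/g)^k * of_bool (k \<ge> m))"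
    by (intro suminf_split_initial_segment summable_atom assms)
  also have "\<dots> = (\<Sum>k. (1/g)^m * (1/g)^k)" by (simp add: power_add mult_ac)
  also have "\<dots> = (1/g)^m * (\<Sum>k. (1/g)^k)" using assms by (intro suminf_mult) (simp add: summable_geometric)
  also have "\<dots> = (1/g)^m * g / (g - 1)"
    using assms by (subst suminf_geometric) (auto simp: field_simps)
  finally show ?thesis .
qed

text \<open>Time 0 misses \<open>x\<close> because the orbit starts at 1, so
  \<open>atom_split\<close> applies with \<open>m = 1\<close>. Equality leaves no weight for misses,
  which forces every later orbit point onto \<open>x\<close>.\<close>

lemma atom_le:
  assumes "g > 1" "x < 1"
  shows "atom g x \<le> 1 / (g - 1)"
    and "atom g x = 1 / (g - 1) \<Longrightarrow> orbit g 1 (Suc k) = x"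
proof -
  let ?R = "\<Sum>k. (1/g)^k * of_bool (k \<ge> 1 \<and> orbit g 1 k \<noteq> x)"
  have split: "atom g x + ?R = 1 / (g - 1)"
    using atom_split[of g 1 x] assms by simp
  have R: "?R \<ge> 0" using assms by (intro suminf_nonneg summable_atom) auto
  show "atom g x \<le> 1 / (g - 1)" using split R by simp
  assume "atom g x = 1 / (g - 1)"
  then have "?R = 0" using split by simp
  then have "\<forall>k. (1/g)^k * of_bool (k \<ge> 1 \<and> orbit g 1 k \<noteq> x) = 0"
    using assms by (subst (asm) suminf_eq_zero_iff[OF summable_atom]) auto
  from this[rule_format, of "Suc k"] show "orbit g 1 (Suc k) = x" using assms by (auto split: if_splits)
qed

text \<open>Times 0 and 1 both miss \<open>x\<close>, leaving at most the tail from 2 on, which is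
  \<open>1 / (g * (g - 1))\<close>. This is below \<open>1 / g\<close> because
  \<open>g > 2\<close>.\<close>

lemma atom_less:
  assumes g: "g > 2" and x: "x < 1" "x \<noteq> frac g"
  shows "atom g x < 1 / g"
proof -
  let ?R = "\<Sum>k. (1/g)^k * of_bool (k \<ge> 2 \<and> orbit g 1 k \<noteq> x)"
  have "orbit g 1 k \<noteq> x" if "k < 2" for k
    using that x by (cases k) (auto simp: less_2_cases_iff)
  then have split: "atom g x + ?R = (1/g)^2 * g / (g - 1)"
    using g by (intro atom_split) auto
  have "?R \<ge> 0" using g by (intro suminf_nonneg summable_atom) auto
  then have "atom g x \<le> (1/g)^2 * g / (g - 1)" using split by simp
  also have "\<dots> = (1/g) * (1 / (g - 1))" using g by (simp add: power2_eq_square)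
  also have "\<dots> < (1/g) * 1" using g by (intro mult_strict_left_mono) (auto simp: divide_less_eq_1)
  finally show ?thesis by simp
qed

text \<open>If the fractional parts differed, the atom at \<open>frac g\<close> would have mass at
  least \<open>1 / g\<close> and less than \<open>1 / h\<close>. The same comparison at
  \<open>frac h\<close> gives the opposite inequality.\<close>

lemma frac_eq_of_atoms_eq:
  assumes g: "g > 2" and h: "h > 2" and ng: "g \<notin> \<int>"
    and eq: "\<And>x. 0 < x \<Longrightarrow> x < 1 \<Longrightarrow> atom g x = atom h x"
  shows "frac g = frac h"
proof (rule ccontr)
  assume ne: "frac g \<noteq> frac h"
  have gi: "0 < frac g" "frac g < 1" using ng by (auto simp: frac_lt_1)
  have 1: "1 / g \<le> atom g (frac g)" using atom_ge_term[of g 1] g by simp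
  have "atom h (frac g) < 1 / h" using ne h gi by (intro atom_less) auto
  then have hg: "1 / g < 1 / h" using 1 eq[OF gi] by simp
  \<comment> \<open>For an integer \<open>h\<close> the orbit of 1 drops to 0 at once, so there
    would be no atom inside \<open>(0,1)\<close> to match the one at \<open>frac g\<close>.\<close>
  have nh: "h \<notin> \<int>"
  proof
    assume "h \<in> \<int>"
    then have "orbit h 1 (Suc k) = 0" for k
      by (induction k) (auto simp: orbit_Suc Tmap_def)
    then have "orbit h 1 k \<noteq> frac g" for k using gi by (cases k) auto
    then have "atom h (frac g) = 0" by (simp add: kink_def)
    then show False using 1 eq[OF gi] g by (simp add: field_simps)
  qed
  have hi: "0 < frac h" "frac h < 1" using nh by (auto simp: frac_lt_1)
  have "1 / h \<le> atom h (frac h)" using atom_ge_term[of h 1] h by simp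
  moreover have "atom g (frac h) < 1 / g" using ne g hi by (intro atom_less) auto
  ultimately show False using eq[OF hi] hg by simp
qed

text \<open>Equal fractional parts give \<open>h \<ge> g + 1\<close>, so the common atom is squeezed
  between \<open>1 / g\<close> and \<open>1 / (h - 1) \<le> 1 / g\<close>. Equality throughout fixes
  \<open>h\<close> and concentrates its orbit after time 0 on a single point.\<close>

lemma slopes_of_atoms_eq:
  assumes g: "g > 2" and h: "h > g" and ng: "g \<notin> \<int>"
    and eq: "\<And>x. 0 < x \<Longrightarrow> x < 1 \<Longrightarrow> atom g x = atom h x"
  shows "h = g + 1" and "orbit g 1 (Suc (Suc k)) = 0"
proof -
  let ?w = "frac g"
  have w: "0 < ?w" "?w < 1" using ng by (auto simp: frac_lt_1)
  have fr: "?w = frac h" using frac_eq_of_atoms_eq[OF g _ ng eq] h g by auto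
  then have "h - g = of_int (\<lfloor>h\<rfloor> - \<lfloor>g\<rfloor>)" by (simp add: frac_def)
  then have h1: "h \<ge> g + 1" using h
    by (metis add_le_cancel_left diff_gt_0_iff_gt le_add_diff_inverse less_imp_le of_int_0_less_iff of_int_1_le_iff zless_imp_add1_zle add_0)
  have "1 / g \<le> atom g ?w" using atom_ge_term[of g 1] g by simp
  moreover have "atom g ?w = atom h ?w" using eq w by simp
  moreover have "atom h ?w \<le> 1 / (h - 1)" using atom_le(1)[of h ?w] g h w by simp
  moreover have "1 / (h - 1) \<le> 1 / g" using h1 g by (intro divide_left_mono) auto
  ultimately have e: "atom g ?w = 1 / g" "atom h ?w = 1 / (h - 1)" "1 / (h - 1) = 1 / g" by linarith+
  show "h = g + 1" using e(3) g h by (simp add: field_simps)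
  have hw: "orbit h 1 (Suc k) = ?w" for k using atom_le(2)[OF _ _ e(2)] g h w by simp
  let ?y = "orbit g 1 (Suc (Suc k))"
  show "?y = 0"
  proof (rule ccontr)
    assume "?y \<noteq> 0"
    then have y: "0 < ?y" "?y < 1" using orbit_bounds[of 1 g "Suc (Suc k)"] orbit_Suc_less_1[of g 1 "Suc k"] by auto
    have pos: "0 < (1/g)^Suc (Suc k)" using g by simp
    show False
    \<comment> \<open>A nonzero later point of the \<open>g\<close>-orbit would either raise the
      atom at \<open>?w\<close> above \<open>1 / g\<close> or create an atom that \<open>h\<close>
      does not have.\<close>
    proof (cases "?y = ?w")
      case True
      have "(1/g)^1 + (1/g)^Suc (Suc k) \<le> atom g ?w"
        using g True by (intro atom_ge_two_terms) auto
      then show False using e(1) pos by simp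
    next
      case False
      have "orbit h 1 j \<noteq> ?y" for j using hw[of "j - 1"] False y by (cases j) auto
      then have "atom h ?y = 0" by (simp add: kink_def)
      moreover have "(1/g)^Suc (Suc k) \<le> atom g ?y" using g by (intro atom_ge_term) auto
      ultimately show False using eq[OF y] pos by simp
    qed
  qed
qed


section \<open>The measures \<open>acim\<close> in terms of Parry's measure\<close>

lemma acim_nat_left:
  assumes "n \<ge> 2" "b > 1"
  shows "acim (real n) b = parry (real n * b)"
  unfolding acim_def Tmap_nat_comp
proof (rule the_equality)
  have "1 * 1 < real n * b" using assms by (intro mult_strict_mono) auto
  then have g: "real n * b > 1" by simp
  show *: "prob_space (parry (real n * b)) \<and> sets (parry (real n * b)) = sets unit_borel \<and>
      absolutely_continuous unit_leb (parry (real n * b)) \<and>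
      distr (parry (real n * b)) unit_borel (Tmap (real n * b)) = parry (real n * b)"
    using prob_space_parry[OF g] absolutely_continuous_parry distr_parry[OF g] by simp
  fix M assume "prob_space M \<and> sets M = sets unit_borel \<and> absolutely_continuous unit_leb M \<and>
      distr M unit_borel (Tmap (real n * b)) = M"
  then show "M = parry (real n * b)" using * by (elim conjE) (rule invariant_measure_unique[OF g])
qed

text \<open>\<open>T\<^sub>n\<close> and \<open>T\<^sub>\<beta>\<close> carry the invariant measures of \<open>T\<^sub>\<beta> \<circ> T\<^sub>n\<close> and of \<open>T\<^sub>n \<circ> T\<^sub>\<beta>\<close> to each other,
  so existence and uniqueness for the latter give both for the former.\<close>

lemma acim_nat_right:
  assumes n: "n \<ge> 2" and b: "b > 1"
  shows "acim b (real n) = distr (parry (real n * b)) unit_borel (Tmap b)"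
  unfolding acim_def
proof (rule the_equality)
  let ?P = "parry (real n * b)"
  have "1 * 1 < real n * b" using assms by (intro mult_strict_mono) auto
  then have g: "real n * b > 1" by simp
  have comp: "distr (distr M unit_borel (Tmap c)) unit_borel (Tmap d) = distr M unit_borel (Tmap d \<circ> Tmap c)"
    if "sets M = sets unit_borel" for M c d
    using that by (intro distr_distr) auto
  have push: "prob_space (distr M unit_borel (Tmap c)) \<and> sets (distr M unit_borel (Tmap c)) = sets unit_borel \<and>
      absolutely_continuous unit_leb (distr M unit_borel (Tmap c))"
    if "prob_space M" "sets M = sets unit_borel" "absolutely_continuous unit_leb M" "c > 0" for M c
    using that absolutely_continuous_distr_Tmap by (auto intro: prob_space.prob_space_distr)
  have P: "distr ?P unit_borel (Tmap (real n) \<circ> Tmap b) = ?P"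
    unfolding Tmap_nat_comp by (rule distr_parry[OF g])
  have "distr (distr ?P unit_borel (Tmap b)) unit_borel (Tmap b \<circ> Tmap (real n))
      = distr (distr ?P unit_borel (Tmap (real n) \<circ> Tmap b)) unit_borel (Tmap b)"
    by (simp add: comp[symmetric])
  then have "distr (distr ?P unit_borel (Tmap b)) unit_borel (Tmap b \<circ> Tmap (real n)) = distr ?P unit_borel (Tmap b)"
    unfolding P .
  then show "prob_space (distr ?P unit_borel (Tmap b)) \<and> sets (distr ?P unit_borel (Tmap b)) = sets unit_borel \<and>
      absolutely_continuous unit_leb (distr ?P unit_borel (Tmap b)) \<and>
      distr (distr ?P unit_borel (Tmap b)) unit_borel (Tmap b \<circ> Tmap (real n)) = distr ?P unit_borel (Tmap b)"
    using push[of ?P b] prob_space_parry[OF g] absolutely_continuous_parry b by simp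
  fix M assume "prob_space M \<and> sets M = sets unit_borel \<and> absolutely_continuous unit_leb M \<and>
      distr M unit_borel (Tmap b \<circ> Tmap (real n)) = M"
  then have M: "prob_space M" "sets M = sets unit_borel" "absolutely_continuous unit_leb M"
    and inv: "distr M unit_borel (Tmap b \<circ> Tmap (real n)) = M" by auto
  \<comment> \<open>Pushing \<open>M\<close> forward by the integer map gives a measure invariant
    under the composition in the other order, hence Parry's measure; pushing it on by
    \<open>Tmap b\<close> returns \<open>M\<close>.\<close>
  let ?N = "distr M unit_borel (Tmap (real n))"
  have "distr ?N unit_borel (Tmap b) = M" using comp[OF M(2)] inv by simp
  moreover have "?N = ?P"
  proof (rule invariant_measure_unique[OF g])
    have "distr ?N unit_borel (Tmap (real n) \<circ> Tmap b) = distr (distr ?N unit_borel (Tmap b)) unit_borel (Tmap (real n))"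
      by (simp add: comp)
    then show "distr ?N unit_borel (Tmap (real n * b)) = ?N"
      unfolding Tmap_nat_comp \<open>distr ?N unit_borel (Tmap b) = M\<close> .
  qed (use push[OF M, of "real n"] n prob_space_parry[OF g] absolutely_continuous_parry distr_parry[OF g] in auto)
  ultimately show "M = distr ?P unit_borel (Tmap b)" by simp
qed

section \<open>Kinks of the distribution functions of both components\<close>

lemma summable_parry_weights:
  fixes g c :: real
  assumes "g > 1" "c > 0"
  shows "summable (\<lambda>k. \<bar>(1/g)^k / c\<bar>)"
proof -
  have "\<bar>(1/g)^k / c\<bar> = (1/g)^k / c" for k using assms by (intro abs_of_nonneg) simp
  then show ?thesis using assms by (simp only:) (intro summable_divide summable_geometric, simp)
qed

lemma kink_divide:
  assumes "g > 1"
  shows "kink (\<lambda>k. (1/g)^k / c) u x = kink (\<lambda>k. (1/g)^k) u x / c"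
  using suminf_divide[OF summable_atom[OF assms, of "\<lambda>k. u k = x"], of c]
  by (simp add: kink_def)

text \<open>Kinks give the atoms only up to the normalising constants, so these are compared first,
  through the kink at 1.\<close>

lemma parry_eqD:
  assumes g: "g > 1" and h: "h > 1" and eq: "parry g = parry h"
  shows "pot g 1 {0..<1} = pot h 1 {0..<1}" and "\<And>x. 0 < x \<Longrightarrow> x < 1 \<Longrightarrow> atom g x = atom h x"
proof -
  let ?c = "\<lambda>g. pot g 1 {0..<1}" and ?a = "\<lambda>g k. (1/g)^k / pot g 1 {0..<1}"
  have c: "?c g \<ge> 1" "?c h \<ge> 1" using pot_unit_ge_1 g h by auto
  \<comment> \<open>The formula is continued past 1, where the distribution function is constant, so
    that 1 becomes an interior point of the interval of agreement.\<close>
  have sum: "(\<Sum>k. ?a g k * min t (orbit g 1 k)) = measure (parry g) {0..<min t 1}" if "g > 1" "t \<ge> 0" for g t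
  proof -
    have m: "min t (orbit g 1 k) = min (min t 1) (orbit g 1 k)" for k
      using orbit_bounds[of 1 g k] by simp
    have "summable (\<lambda>k. (1/g)^k * min (min t 1) (orbit g 1 k))"
      by (intro summable_min orbit_bounds summable_parry_weights[OF that(1), of 1, simplified div_by_1]) simp_all
    from suminf_divide[OF this, of "?c g"]
    have "(\<Sum>k. ?a g k * min t (orbit g 1 k)) = (\<Sum>k. (1/g)^k * min (min t 1) (orbit g 1 k)) / ?c g"
      unfolding m by simp
    also have "\<dots> = measure (parry g) {0..<min t 1}"
      using that(2) by (intro measure_parry_Ico[OF that(1), symmetric]) simp_all
    finally show ?thesis .
  qed
  have kink: "kink (?a g) (orbit g 1) x = kink (?a h) (orbit h 1) x" if x: "0 < x" "x < 2" for x
  proof (rule kink_eqI[where A = 0 and B = 0, OF _ _ _ _ _ _ x])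
    show "0 * t + (\<Sum>k. ?a g k * min t (orbit g 1 k)) = 0 * t + (\<Sum>k. ?a h k * min t (orbit h 1 k))" if "0 < t" for t
      unfolding sum[OF g less_imp_le[OF that]] sum[OF h less_imp_le[OF that]] eq ..
    show "summable (\<lambda>k. \<bar>?a g k\<bar>)" "summable (\<lambda>k. \<bar>?a h k\<bar>)"
      using c by (intro summable_parry_weights g h; simp)+
  qed (simp_all add: orbit_bounds)
  \<comment> \<open>All later orbit points lie below 1, so only \<open>k = 0\<close> contributes to
    the kink at 1.\<close>
  have "kink (?a g) (orbit g 1) 1 = 1 / ?c g" if "g > 1" for g
  proof -
    have "orbit g 1 k = 1 \<longleftrightarrow> k = 0" for k using orbit_Suc_less_1[of g 1 "k - 1"] by (cases k) auto
    then have "kink (?a g) (orbit g 1) 1 = (\<Sum>k\<in>{0}. ?a g k * of_bool (orbit g 1 k = 1))"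
      unfolding kink_def by (intro suminf_finite) auto
    then show ?thesis by simp
  qed
  then have "1 / ?c g = 1 / ?c h" using kink[of 1] g h by simp
  then show cc: "?c g = ?c h" by simp
  show "atom g x = atom h x" if "0 < x" "x < 1" for x
    using kink[of x] that c by (simp add: kink_divide[OF g] kink_divide[OF h] cc)
qed

text \<open>Each interval \<open>[0, w)\<close> in Parry's series is folded by \<open>Tmap b\<close>
  into full branches, which contribute linearly in \<open>t\<close>, and one partial branch ending
  at \<open>Tmap b w\<close>. The slope \<open>A\<close> collects the full branches.\<close>

lemma measure_distr_parry_Ico:
  assumes g: "g > 1" and b: "b > 0"
  shows "\<exists>A. \<forall>t. 0 \<le> t \<longrightarrow> t \<le> 1 \<longrightarrow> measure (distr (parry g) unit_borel (Tmap b)) {0..<t} =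
    A * t + (\<Sum>k. (1/g)^k / (pot g 1 {0..<1} * b) * min t (Tmap b (orbit g 1 k)))"
proof (intro exI allI impI)
  let ?c = "pot g 1 {0..<1}" and ?w = "orbit g 1"
  let ?A = "\<Sum>k. (1/g)^k / (?c * b) * of_int \<lfloor>b * ?w k\<rfloor>"
  fix t :: real assume t: "0 \<le> t" "t \<le> 1"
  have c: "?c \<ge> 1" using pot_unit_ge_1[OF g] .
  have w: "0 \<le> ?w k" "?w k \<le> 1" for k using orbit_bounds[of 1 g k] by auto
  have sw: "summable (\<lambda>k. \<bar>(1/g)^k / (?c * b)\<bar>)" using g c b by (intro summable_parry_weights) auto
  have s1: "summable (\<lambda>k. (1/g)^k / (?c * b) * min t (Tmap b (?w k)))"
    using sw by (intro summable_min) (auto simp: less_imp_le)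
  have s2: "summable (\<lambda>k. (1/g)^k / (?c * b) * of_int \<lfloor>b * ?w k\<rfloor>)"
  proof (rule summable_comparison_test')
    show "summable (\<lambda>k. \<bar>(1/g)^k / (?c * b)\<bar> * b)" using sw by (rule summable_mult2)
    show "norm ((1/g)^k / (?c * b) * of_int \<lfloor>b * ?w k\<rfloor>) \<le> \<bar>(1/g)^k / (?c * b)\<bar> * b" if "k \<ge> 0" for k
    proof -
      have "0 \<le> b * ?w k" "b * ?w k \<le> b" using b w[of k] by (auto simp: mult_left_le)
      moreover from this have "(0 :: real) \<le> of_int \<lfloor>b * ?w k\<rfloor>" by simp
      ultimately have "\<bar>of_int \<lfloor>b * ?w k\<rfloor>\<bar> \<le> b" using of_int_floor_le[of "b * ?w k"] by linarith
      then show ?thesis unfolding real_norm_def abs_mult by (intro mult_left_mono) auto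
    qed
  qed
  have "measure (distr (parry g) unit_borel (Tmap b)) {0..<t} = measure (parry g) (Tmap b -` {0..<t} \<inter> {0..<1})"
    using t by (subst measure_distr) (auto simp: parry_def)
  also have "\<dots> = pot g 1 (Tmap b -` {0..<t} \<inter> {0..<1}) / ?c"
    using t by (intro measure_parry[OF g]) simp
  also have "\<dots> = (\<Sum>k. (1/g)^k * measure unit_leb (Tmap b -` {0..<t} \<inter> {0..<1} \<inter> {0..<?w k}) / ?c)"
    unfolding pot_def by (intro suminf_divide[symmetric] pot_summable g)
  also have "\<dots> = (\<Sum>k. t * ((1/g)^k / (?c * b) * of_int \<lfloor>b * ?w k\<rfloor>) + (1/g)^k / (?c * b) * min t (Tmap b (?w k)))"
  proof (intro suminf_cong)
    fix k
    have "{0..<t} \<inter> {0..<Tmap b (?w k)} = {0..<min t (Tmap b (?w k))}" by auto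
    then have m: "measure unit_leb ({0..<t} \<inter> {0..<Tmap b (?w k)}) = min t (Tmap b (?w k))"
      using t by (simp add: measure_unit_leb_Ico)
    show "(1/g)^k * measure unit_leb (Tmap b -` {0..<t} \<inter> {0..<1} \<inter> {0..<?w k}) / ?c =
        t * ((1/g)^k / (?c * b) * of_int \<lfloor>b * ?w k\<rfloor>) + (1/g)^k / (?c * b) * min t (Tmap b (?w k))"
      using t by (subst Tmap_transfer[OF _ b w]) (simp_all add: m measure_unit_leb_Ico add_divide_distrib distrib_left mult_ac)
  qed
  also have "\<dots> = t * ?A + (\<Sum>k. (1/g)^k / (?c * b) * min t (Tmap b (?w k)))"
    by (subst suminf_add[symmetric, OF summable_mult[OF s2] s1]) (simp only: suminf_mult[OF s2])
  finally show "measure (distr (parry g) unit_borel (Tmap b)) {0..<t} =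
      ?A * t + (\<Sum>k. (1/g)^k / (?c * b) * min t (Tmap b (?w k)))" by simp
qed

section \<open>Conclusion: the two components together determine the base\<close>

lemma nat_mult_gt_2: "n \<ge> 2 \<Longrightarrow> b > 1 \<Longrightarrow> real n * b > 2"
  using mult_le_less_imp_less[of 2 "real n" 1 b] by simp

lemma irrational_nat_mult:
  assumes "b \<notin> \<rat>" "n \<noteq> 0"
  shows "real n * b \<notin> \<rat>"
proof
  assume "real n * b \<in> \<rat>"
  then have "real n * b / real n \<in> \<rat>" by (intro Rats_divide) auto
  then show False using assms by simp
qed

lemma acim_neq_of_less:
  assumes b: "b > 1" "b \<notin> \<rat>" and n: "n \<ge> 2" and less: "b < b'"
    and eq: "acim (real n) b = acim (real n) b'" "acim b (real n) = acim b' (real n)"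
  shows False
proof -
  define g h where "g = real n * b" and "h = real n * b'"
  have b': "b' > 1" using b less by simp
  have gh: "g > 2" "h > 2" "g > 1" "h > 1" "h > g"
    using nat_mult_gt_2[OF n b(1)] nat_mult_gt_2[OF n b'] less n unfolding g_def h_def by auto
  have gi: "g \<notin> \<int>" using irrational_nat_mult[OF b(2), of n] n Ints_subset_Rats unfolding g_def by auto
  have "parry g = parry h"
    using eq(1) acim_nat_left[OF n b(1)] acim_nat_left[OF n b'] unfolding g_def h_def by simp
  note D = parry_eqD[OF gh(3,4) this]
  have hg: "h = g + 1" and orb: "\<And>k. orbit g 1 (Suc (Suc k)) = 0"
    using slopes_of_atoms_eq[OF gh(1,5) gi D(2)] by auto
  have bb: "b' = b + 1 / real n" using hg n by (simp add: g_def h_def field_simps)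
  have irr: "b' \<notin> \<rat>"
  proof
    assume "b' \<in> \<rat>"
    then have "b' - 1 / real n \<in> \<rat>" by (intro Rats_diff Rats_divide) auto
    then show False using b bb by simp
  qed
  let ?c = "pot g 1 {0..<1}"
  have c: "?c \<ge> 1" using pot_unit_ge_1[OF gh(3)] .
  have distr: "distr (parry g) unit_borel (Tmap b) = distr (parry h) unit_borel (Tmap b')"
    using eq(2) acim_nat_right[OF n b(1)] acim_nat_right[OF n b'] unfolding g_def h_def by simp
  obtain A where A: "\<forall>t. 0 \<le> t \<longrightarrow> t \<le> 1 \<longrightarrow> measure (distr (parry g) unit_borel (Tmap b)) {0..<t} =
      A * t + (\<Sum>k. (1/g)^k / (?c * b) * min t (Tmap b (orbit g 1 k)))"
    using measure_distr_parry_Ico[OF gh(3), of b] b by auto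
  obtain B where B: "\<forall>t. 0 \<le> t \<longrightarrow> t \<le> 1 \<longrightarrow> measure (distr (parry h) unit_borel (Tmap b')) {0..<t} =
      B * t + (\<Sum>k. (1/h)^k / (?c * b') * min t (Tmap b' (orbit h 1 k)))"
    using measure_distr_parry_Ico[OF gh(4), of b'] b' unfolding D(1)[symmetric] by auto
  have AB: "A * t + (\<Sum>k. (1/g)^k / (?c * b) * min t (Tmap b (orbit g 1 k))) =
      B * t + (\<Sum>k. (1/h)^k / (?c * b') * min t (Tmap b' (orbit h 1 k)))" if "0 < t" "t < 1" for t
    using A[rule_format, of t] B[rule_format, of t] that unfolding distr by linarith
  \<comment> \<open>The image of the starting point 1 of the \<open>h\<close>-orbit under
    \<open>Tmap b'\<close>. The term \<open>k = 0\<close> therefore makes the kink on the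
    \<open>b'\<close> side positive.\<close>
  let ?x = "frac b'"
  have "b' \<notin> \<int>" using irr Ints_subset_Rats by auto
  then have x: "0 < ?x" "?x < 1" by (auto simp: frac_lt_1)
  have "kink (\<lambda>k. (1/g)^k / (?c * b)) (\<lambda>k. Tmap b (orbit g 1 k)) ?x =
      kink (\<lambda>k. (1/h)^k / (?c * b')) (\<lambda>k. Tmap b' (orbit h 1 k)) ?x"
  proof (rule kink_eqI[OF _ _ _ _ _ _ x AB])
    show "summable (\<lambda>k. \<bar>(1/g)^k / (?c * b)\<bar>)" "summable (\<lambda>k. \<bar>(1/h)^k / (?c * b')\<bar>)"
      using c b b' by (intro summable_parry_weights gh; simp)+
  qed (simp_all add: less_imp_le)
  moreover have "kink (\<lambda>k. (1/h)^k / (?c * b')) (\<lambda>k. Tmap b' (orbit h 1 k)) ?x > 0"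
    unfolding kink_divide[OF gh(4)] kink_def
    using b' c gh summable_atom[OF gh(4)]
    by (intro divide_pos_pos suminf_pos2[where i = 0]) (auto simp: Tmap_def)
  moreover have "kink (\<lambda>k. (1/g)^k / (?c * b)) (\<lambda>k. Tmap b (orbit g 1 k)) ?x = 0"
  proof -
    have "Tmap b (orbit g 1 k) \<noteq> ?x" for k
    proof (cases k)
      case 0
      \<comment> \<open>The two bases differ by \<open>1 / real n\<close>, which is not an integer
        since \<open>n \<ge> 2\<close>.\<close>
      have "frac b \<noteq> frac b'"
      proof
        assume "frac b = frac b'"
        then have "1 / real n = of_int (\<lfloor>b'\<rfloor> - \<lfloor>b\<rfloor>)" using bb by (simp add: frac_def)
        then have "1 / real n \<in> \<int>" by (metis Ints_of_int)
        then show False using n frac_eq[of "1 / real n"] frac_eq_0_iff[of "1 / real n"] by simp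
      qed
      then show ?thesis using 0 by (simp add: Tmap_def)
    next
      case (Suc j)
      show ?thesis
      proof (cases j)
        case 0
        \<comment> \<open>Applying the integer map to this point gives the orbit point at time 2,
          which is 0. So \<open>n\<close> times it is an integer, and the point is rational, unlike
          \<open>?x\<close>.\<close>
        have "Tmap (real n) (Tmap b (orbit g 1 k)) = orbit g 1 (Suc k)"
          using fun_cong[OF Tmap_nat_comp[of n b], of "orbit g 1 k"] by (simp add: orbit_Suc g_def)
        also have "\<dots> = 0" unfolding Suc by (rule orb)
        finally have "real n * Tmap b (orbit g 1 k) \<in> \<int>" unfolding Tmap_def[of "real n"] by simp
        then have "Tmap b (orbit g 1 k) \<in> \<rat>"
          using irrational_nat_mult[of "Tmap b (orbit g 1 k)" n] n Ints_subset_Rats by auto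
        moreover have "?x \<notin> \<rat>" using irr by simp
        ultimately show ?thesis by metis
      next
        case (Suc i)
        then have "orbit g 1 k = 0" using \<open>k = Suc j\<close> orb by simp
        then show ?thesis using x by (simp add: Tmap_def)
      qed
    qed
    then show ?thesis by (simp add: kink_def)
  qed
  ultimately show False by simp
qed

theorem theorem3p3:
  fixes \<beta> \<beta>' :: real and n :: nat
  assumes "\<beta> > 1" and "\<beta> \<notin> \<rat>" and "n \<ge> 2"
    and "\<beta>' > 1" and "\<beta>' \<noteq> \<beta>"
  shows "alt_acim \<beta> n \<noteq> alt_acim \<beta>' n"
proof
  assume eq: "alt_acim \<beta> n = alt_acim \<beta>' n"
  have sets: "sets (acim (real n) b) = sets unit_borel" "sets (acim b (real n)) = sets unit_borel"
    if "b > 1" for b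
    using acim_nat_left[OF assms(3) that] acim_nat_right[OF assms(3) that] by simp_all
  have acims: "acim (real n) \<beta> = acim (real n) \<beta>'" "acim \<beta> (real n) = acim \<beta>' (real n)"
    using alt_acim_eqD[OF sets[OF assms(1)] sets[OF assms(4)] eq] .
  show False
  proof (cases "\<beta> < \<beta>'")
    case True
    then show False using acim_neq_of_less assms acims by blast
  next
    case False
    \<comment> \<open>Here \<open>\<beta>'\<close> is the smaller base, and
      \<open>acim_neq_of_less\<close> needs that one irrational. The first component gives equal
      fractional parts of \<open>g\<close> and \<open>h\<close>, so they differ by an integer and
      irrationality passes to \<open>\<beta>'\<close>.\<close>
    define g h where "g = real n * \<beta>" and "h = real n * \<beta>'"
    have gh: "g > 2" "h > 2"
      using nat_mult_gt_2 assms unfolding g_def h_def by auto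
    have gi: "g \<notin> \<int>"
      using irrational_nat_mult[OF assms(2), of n] assms(3) Ints_subset_Rats unfolding g_def by auto
    have "parry g = parry h"
      using acims(1) acim_nat_left assms unfolding g_def h_def by metis
    then have "frac g = frac h"
      using gh parry_eqD(2)[of g h] by (intro frac_eq_of_atoms_eq[OF gh gi]) auto
    then have gh': "g = h + of_int (\<lfloor>g\<rfloor> - \<lfloor>h\<rfloor>)" by (simp add: frac_def)
    have "\<beta>' \<notin> \<rat>"
    proof
      assume "\<beta>' \<in> \<rat>"
      then have "g \<in> \<rat>" by (subst gh') (auto simp: h_def intro!: Rats_add Rats_mult)
      then show False using irrational_nat_mult[OF assms(2), of n] assms(3) by (simp add: g_def)
    qed
    then show False using acim_neq_of_less[of \<beta>' n \<beta>] False assms acims by simp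
  qed
qed

end
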